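(* Let $I=[c,d]\subset\Omega\subset\mathbb{R}$ be a closed bounded interval ($c<d$) and let $f\in\mathrm{BV}(I)$ be left-continuous. If $a:\Omega\to[0,\infty)$ is bounded and $\alpha$-Hölder continuous, $\alpha\in(0,1]$, and $q>1$ satisfies $$q<1+\frac{\alpha}{n},\qquad\text{where } n=1 \text{ is the dimension},$$ then, for $\varphi(x,t):=t+a(x)t^q$, we have $|D^sf|(\{a>0\})=0$ and $$\overline{\mathrm V}^\varphi_I(f)=\int_I |f'(x)|+a(x)\,|f'(x)|^q\,dx+|D^sf|(\{a=0\}).$$
   Context: For $A\subset I$ let $\varphi^+_A(t):=\sup_{x\in A}\varphi(x,t)$. A partition $(I_k)_{k=1}^m$ of $I$ is a finite family of non-degenerate closed intervals with disjoint interiors and union $I$; $|(I_k)|:=\max_k|I_k|$. For $I_k=[a_k,b_k]$, $\Delta_kf:=f(a_k)-f(b_k)$. Define $$\overline{\mathrm V}^\varphi_I(f):=\limsup_{|(I_k)|\to0}\sum_{k=1}^m\varphi^+_{I_k}\Big(\frac{|\Delta_kf|}{|I_k|}\Big)|I_k|,$$ i.e. the limit as $\delta\to0^+$ of the supremum of the sums over all partitions with $|(I_k)|<\delta$. For a left-continuous function $f:[c,d]\to\mathbb{R}$ of bounded variation, $Df$ denotes the finite signed Borel measure on $I$ with $f(x)=f(c)+Df([c,x))$ for every $x\in I$ and $Df(\{d\})=0$ (so a jump of $f$ immediately to the right of $c$ is an atom of $Df$ at $c$). Its Lebesgue decomposition with respect to Lebesgue measure is $Df=f'\,dx+D^sf$,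 with $D^sf$ the singular part and $|D^sf|$ its total variation measure. The sets $\{a>0\}$ and $\{a=0\}$ are understood as subsets of $I$.
   Formalization: The vanishing |D^s f|({a>0})=0 is proved when the upper variation of f is finite (it fails, e.g., for a step function with a=1), and the formula is proved, also with infinite values, whenever |D^s f|({a>0})=0. *)

theory Defs
  imports "HOL-Analysis.Analysis"
begin

text \<open>
  The library's \<open>division_of\<close> allows degenerate intervals; nonempty interiors exclude them. The
  remaining intervals are automatically distinct, so a set of intervals represents the family.
\<close>

definition interval_partition :: "real set \<Rightarrow> real set set \<Rightarrow> bool" where
  "interval_partition I P \<longleftrightarrow> P division_of I \<and> (\<forall>K\<in>P. interior K \<noteq> {})"

definition mesh :: "real set set \<Rightarrow> real" where
  "mesh P = Max (measure lborel ` P)"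

definition increment :: "(real \<Rightarrow> real) \<Rightarrow> real set \<Rightarrow> real" where
  "increment f K = f (Inf K) - f (Sup K)"

definition phi_plus :: "(real \<Rightarrow> real \<Rightarrow> ennreal) \<Rightarrow> real set \<Rightarrow> real \<Rightarrow> ennreal" where
  "phi_plus \<phi> A t = (SUP x\<in>A. \<phi> x t)"

definition riesz_sum :: "(real \<Rightarrow> real \<Rightarrow> ennreal) \<Rightarrow> (real \<Rightarrow> real) \<Rightarrow> real set set \<Rightarrow> ennreal" where
  "riesz_sum \<phi> f P =
     (\<Sum>K\<in>P. phi_plus \<phi> K (\<bar>increment f K\<bar> / measure lborel K) * ennreal (measure lborel K))"

definition riesz_sup ::
    "(real \<Rightarrow> real \<Rightarrow> ennreal) \<Rightarrow> real set \<Rightarrow> (real \<Rightarrow> real) \<Rightarrow> real \<Rightarrow> ennreal" where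
  "riesz_sup \<phi> I f \<delta> = (SUP P \<in> {P. interval_partition I P \<and> mesh P < \<delta>}. riesz_sum \<phi> f P)"

definition upper_variation ::
    "(real \<Rightarrow> real \<Rightarrow> ennreal) \<Rightarrow> real set \<Rightarrow> (real \<Rightarrow> real) \<Rightarrow> ennreal" where
  "upper_variation \<phi> I f = Lim (at_right 0) (riesz_sup \<phi> I f)"

text \<open>The limit always exists in \<open>[0,\<infinity>]\<close>, by monotonicity, so \<^const>\<open>Lim\<close> is never unspecified here.\<close>

lemma riesz_sup_tendsto_INF:
  "(riesz_sup \<phi> I f \<longlongrightarrow> (INF \<delta>\<in>{0<..}. riesz_sup \<phi> I f \<delta>)) (at_right 0)"
proof (rule order_tendstoI)
  fix u assume "u < (INF \<delta>\<in>{0<..}. riesz_sup \<phi> I f \<delta>)"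
  then have "u < riesz_sup \<phi> I f \<delta>" if "\<delta> > 0" for \<delta>
    using that by (meson INF_lower greaterThan_iff less_le_trans)
  then show "\<forall>\<^sub>F \<delta> in at_right 0. u < riesz_sup \<phi> I f \<delta>"
    by (auto simp: eventually_at_filter)
next
  fix u assume "(INF \<delta>\<in>{0<..}. riesz_sup \<phi> I f \<delta>) < u"
  then obtain \<delta>0 where \<delta>0: "\<delta>0 > 0" "riesz_sup \<phi> I f \<delta>0 < u"
    by (auto simp: INF_less_iff)
  have "riesz_sup \<phi> I f \<delta> < u" if "\<delta> < \<delta>0" for \<delta>
  proof -
    have "riesz_sup \<phi> I f \<delta> \<le> riesz_sup \<phi> I f \<delta>0"
      unfolding riesz_sup_def using that by (intro SUP_subset_mono) auto
    with \<delta>0 show ?thesis by simp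
  qed
  then show "\<forall>\<^sub>F \<delta> in at_right 0. riesz_sup \<phi> I f \<delta> < u"
    using \<delta>0(1) by (auto simp: eventually_at_right_field)
qed

lemma upper_variation_eq_INF:
  "upper_variation \<phi> I f = (INF \<delta>\<in>{0<..}. riesz_sup \<phi> I f \<delta>)"
  unfolding upper_variation_def
  by (rule tendsto_Lim[OF _ riesz_sup_tendsto_INF]) simp

definition bounded_variation_on :: "real set \<Rightarrow> (real \<Rightarrow> real) \<Rightarrow> bool" where
  "bounded_variation_on I f \<longleftrightarrow>
     (\<exists>B. \<forall>P. interval_partition I P \<longrightarrow> (\<Sum>K\<in>P. \<bar>increment f K\<bar>) \<le> B)"

text \<open>
  The libraries have no signed measures. A finite signed measure is a real-valued set function that
  is countably additive on the \<open>\<sigma>\<close>-algebra of \<open>M\<close>; only \<^term>\<open>space M\<close> and \<^term>\<open>sets M\<close> matter.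
  Values outside \<^term>\<open>sets M\<close> are irrelevant.
\<close>

definition signed_measure :: "'a measure \<Rightarrow> ('a set \<Rightarrow> real) \<Rightarrow> bool" where
  "signed_measure M \<mu> \<longleftrightarrow>
     (\<forall>A::nat \<Rightarrow> 'a set. range A \<subseteq> sets M \<longrightarrow> disjoint_family A \<longrightarrow>
        (\<lambda>i. \<mu> (A i)) sums \<mu> (\<Union>i. A i))"

definition total_variation :: "'a measure \<Rightarrow> ('a set \<Rightarrow> real) \<Rightarrow> 'a set \<Rightarrow> ennreal" where
  "total_variation M \<mu> A =
     (SUP P \<in> {P. finite P \<and> P \<subseteq> sets M \<and> disjoint P \<and> \<Union>P = A}. \<Sum>E\<in>P. ennreal \<bar>\<mu> E\<bar>)"

text \<open>
  The half-open interval \<open>[c,x)\<close> matches left-continuity: a jump immediately to the right of \<open>c\<close> is an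
  atom at \<open>c\<close>. The formula does not see \<open>\<mu> {d}\<close>, hence the separate normalisation.
\<close>

definition is_derivative_measure ::
    "real \<Rightarrow> real \<Rightarrow> (real \<Rightarrow> real) \<Rightarrow> (real set \<Rightarrow> real) \<Rightarrow> bool" where
  "is_derivative_measure c d f \<mu> \<longleftrightarrow>
     signed_measure (restrict_space borel {c..d}) \<mu> \<and>
     (\<forall>x\<in>{c..d}. f x = f c + \<mu> {c..<x}) \<and>
     \<mu> {d} = 0"

definition is_lebesgue_decomposition ::
    "real set \<Rightarrow> (real set \<Rightarrow> real) \<Rightarrow> (real \<Rightarrow> real) \<Rightarrow> (real set \<Rightarrow> real) \<Rightarrow> bool" where
  "is_lebesgue_decomposition I \<mu> g \<nu> \<longleftrightarrow>
     set_integrable lborel I g \<and>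
     signed_measure (restrict_space borel I) \<nu> \<and>
     (\<exists>N\<in>null_sets lborel. \<forall>A\<in>sets (restrict_space borel I). A \<inter> N = {} \<longrightarrow> \<nu> A = 0) \<and>
     (\<forall>A\<in>sets (restrict_space borel I). \<mu> A = (LINT x:A|lborel. g x) + \<nu> A)"

definition holder_continuous_on :: "real \<Rightarrow> real set \<Rightarrow> (real \<Rightarrow> real) \<Rightarrow> bool" where
  "holder_continuous_on \<alpha> S a \<longleftrightarrow>
     (\<exists>C. \<forall>x\<in>S. \<forall>y\<in>S. \<bar>a x - a y\<bar> \<le> C * \<bar>x - y\<bar> powr \<alpha>)"

definition double_phase :: "(real \<Rightarrow> real) \<Rightarrow> real \<Rightarrow> real \<Rightarrow> real \<Rightarrow> ennreal" where
  "double_phase a q x t = ennreal (t + a x * t powr q)"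

end

theory Submission
  imports Defs
begin

text \<open>
  Write \<open>\<mu> = Df\<close> and \<open>\<nu> = D\<^sup>sf\<close>, so that the increment of \<open>f\<close> over a partition interval \<open>K = [u,v]\<close> is
  \<open>\<mu> [u,v)\<close> up to sign.

  Upper bound: on \<open>K\<close> we have \<open>sup a \<le> min a + H |K|^\<alpha>\<close>. If \<open>min a > 0\<close>, then \<open>\<mu> = f' dx\<close> on \<open>K\<close> and Jensen's
  inequality bounds the contribution of \<open>min a\<close>. The Hoelder error is at most
  \<open>H |K|^(\<alpha> + 1 - q) |\<mu> K|^q\<close>, and its sum tends to \<open>0\<close> with the mesh because \<open>q < 1 + \<alpha>\<close>.

  Lower bound: along uniform partitions the sums of increments recover \<open>|\<mu>|\<close>, because disjoint Borel sets are
  approximated from inside by disjoint compact sets, which eventually meet different cells. The \<open>q\<close>-growth part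
  is handled by differentiation almost everywhere in \<open>{a > 0}\<close> and Fatou's lemma.

  Vanishing of \<open>\<nu>\<close> on \<open>{a > 0}\<close>: let \<open>C\<close> be a compact Lebesgue null set on which \<open>a \<ge> \<epsilon> > 0\<close>. Since
  \<open>t \<le> L + L^(1 - q) t^q\<close>, the increments over the cells meeting \<open>C\<close> add up to at most \<open>L\<close> times a small length
  plus \<open>L^(1 - q) / \<epsilon>\<close> times a bounded Riesz sum. Letting first the mesh tend to \<open>0\<close> and then \<open>L\<close> to infinity
  gives \<open>\<mu> C = 0\<close>.
\<close>

section \<open>Total variation of a signed measure\<close>

lemma signed_measure_sums:
  assumes "signed_measure M \<mu>" "range A \<subseteq> sets M" "disjoint_family (A::nat \<Rightarrow> 'a set)"
  shows "(\<lambda>i. \<mu> (A i)) sums \<mu> (\<Union>i. A i)"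
  using assms unfolding signed_measure_def by blast

text \<open>The constant series of \<open>\<mu> {}\<close> converges, so its terms tend to
  0.\<close>

lemma signed_measure_empty:
  assumes "signed_measure M \<mu>"
  shows "\<mu> {} = 0"
proof -
  have "(\<lambda>i::nat. \<mu> {}) sums \<mu> (\<Union>i::nat. {})"
    by (rule signed_measure_sums[OF assms]) (auto simp: disjoint_family_on_def)
  then show ?thesis
    using sums_summable summable_LIMSEQ_zero LIMSEQ_const_iff by blast
qed

lemma signed_measure_Un:
  assumes "signed_measure M \<mu>" "A \<in> sets M" "B \<in> sets M" "A \<inter> B = {}"
  shows "\<mu> (A \<union> B) = \<mu> A + \<mu> B"
proof -
  have "(\<lambda>i. \<mu> (binaryset A B i)) sums \<mu> (\<Union>i. binaryset A B i)"
    using assms by (intro signed_measure_sums[OF assms(1)])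
      (auto simp: disjoint_family_on_def binaryset_def)
  moreover have "(\<lambda>i. \<mu> (binaryset A B i)) sums (\<Sum>i<2. \<mu> (binaryset A B i))"
    using signed_measure_empty[OF assms(1)] by (intro sums_finite) (auto simp: binaryset_def)
  ultimately show ?thesis
    using sums_unique2 by (fastforce simp: UN_binaryset_eq binaryset_def numeral_2_eq_2)
qed

lemma signed_measure_Diff:
  assumes "signed_measure M \<mu>" "A \<in> sets M" "B \<in> sets M" "B \<subseteq> A"
  shows "\<mu> (A - B) = \<mu> A - \<mu> B"
  using signed_measure_Un[OF assms(1), of B "A - B"] assms
  by (auto simp: Un_absorb1)

lemma signed_measure_UN_finite:
  assumes "signed_measure M \<mu>" "finite J" "\<And>j. j \<in> J \<Longrightarrow> B j \<in> sets M" "disjoint_family_on B J"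
  shows "\<mu> (\<Union>j\<in>J. B j) = (\<Sum>j\<in>J. \<mu> (B j))"
  using assms(2-)
proof (induction J)
  case empty
  then show ?case using signed_measure_empty[OF assms(1)] by simp
next
  case (insert x F)
  have "\<mu> (B x \<union> (\<Union>j\<in>F. B j)) = \<mu> (B x) + \<mu> (\<Union>j\<in>F. B j)"
    using insert by (intro signed_measure_Un[OF assms(1)] sets.finite_UN)
      (auto simp: disjoint_family_on_def)
  then show ?case using insert by (auto simp: disjoint_family_on_def)
qed

text \<open>The supremum runs over sets of sets, whereas this family is indexed and may repeat a
  member. Disjointness forces a repeated member to be empty, hence of value 0, so reindexing loses
  nothing.\<close>

lemma sum_le_total_variation:
  assumes "signed_measure M \<mu>" "finite J" "\<And>j. j \<in> J \<Longrightarrow> B j \<in> sets M" "disjoint_family_on B J"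
  shows "(\<Sum>j\<in>J. ennreal \<bar>\<mu> (B j)\<bar>) \<le> total_variation M \<mu> (\<Union>j\<in>J. B j)"
proof -
  have "(\<Sum>E\<in>B ` J. ennreal \<bar>\<mu> E\<bar>) = (\<Sum>j\<in>J. ennreal \<bar>\<mu> (B j)\<bar>)"
  proof (subst sum.reindex_nontrivial[OF assms(2)])
    fix x y assume *: "x \<in> J" "y \<in> J" "x \<noteq> y" "B x = B y"
    then have "B x \<inter> B y = {}" using assms(4) by (auto simp: disjoint_family_on_def)
    then show "ennreal \<bar>\<mu> (B x)\<bar> = 0" using * signed_measure_empty[OF assms(1)] by simp
  qed auto
  moreover have "disjoint (B ` J)"
    using disjoint_family_on_disjoint_image[OF assms(4)] .
  ultimately show ?thesis
    unfolding total_variation_def using assms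
    by (intro SUP_upper2[of "B ` J"]) auto
qed

lemma abs_le_total_variation:
  assumes "signed_measure M \<mu>" "A \<in> sets M"
  shows "ennreal \<bar>\<mu> A\<bar> \<le> total_variation M \<mu> A"
  using sum_le_total_variation[OF assms(1), of "{()}" "\<lambda>_. A"] assms
  by (simp add: disjoint_family_on_def)

lemma total_variation_empty:
  assumes "signed_measure M \<mu>"
  shows "total_variation M \<mu> {} = 0"
proof -
  have "(\<Sum>E\<in>P. ennreal \<bar>\<mu> E\<bar>) = 0" if "\<Union>P = {}" for P
    using that signed_measure_empty[OF assms] by (intro sum.neutral) auto
  then have "total_variation M \<mu> {} \<le> 0"
    unfolding total_variation_def by (intro SUP_least) simp
  then show ?thesis by simp
qed

text \<open>If the right-hand side is finite, the series converges absolutely and the triangle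
  inequality for series applies.\<close>

lemma ennreal_abs_sums_le:
  assumes "f sums (x::real)"
  shows "ennreal \<bar>x\<bar> \<le> (\<Sum>i. ennreal \<bar>f i\<bar>)"
proof (cases "(\<Sum>i. ennreal \<bar>f i\<bar>) = top")
  case False
  then have s: "summable (\<lambda>i. \<bar>f i\<bar>)" by (intro summable_suminf_not_top) auto
  then have "(\<Sum>i. ennreal \<bar>f i\<bar>) = ennreal (\<Sum>i. \<bar>f i\<bar>)" by (intro suminf_ennreal2) auto
  moreover have "\<bar>x\<bar> \<le> (\<Sum>i. \<bar>f i\<bar>)" using summable_rabs[OF s] assms sums_unique by metis
  ultimately show ?thesis by (simp add: ennreal_leI)
qed simp

text \<open>Finite partitions of \<open>A\<close> and of \<open>B\<close> together partition
  \<open>A \<union> B\<close>. They can share only the empty set, whose value is 0, so the two sums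
  add up; then each supremum is taken in turn.\<close>

lemma total_variation_superadd:
  assumes "signed_measure M \<mu>" "A \<inter> B = {}"
    and "A \<in> sets M" "B \<in> sets M"
  shows "total_variation M \<mu> A + total_variation M \<mu> B \<le> total_variation M \<mu> (A \<union> B)"
proof -
  have ne: "{P. finite P \<and> P \<subseteq> sets M \<and> disjoint P \<and> \<Union>P = C} \<noteq> {}" if "C \<in> sets M" for C
  proof -
    have "{C} \<in> {P. finite P \<and> P \<subseteq> sets M \<and> disjoint P \<and> \<Union>P = C}" using that by auto
    then show ?thesis by blast
  qed
  have "(\<Sum>E\<in>P. ennreal \<bar>\<mu> E\<bar>) + (\<Sum>E\<in>Q. ennreal \<bar>\<mu> E\<bar>) \<le> total_variation M \<mu> (A \<union> B)"
    if P: "finite P" "P \<subseteq> sets M" "disjoint P" "\<Union>P = A"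
      and Q: "finite Q" "Q \<subseteq> sets M" "disjoint Q" "\<Union>Q = B" for P Q
  proof -
    have "P \<inter> Q \<subseteq> {{}}" using P(4) Q(4) assms(2) by fastforce
    then have "(\<Sum>E\<in>P. ennreal \<bar>\<mu> E\<bar>) + (\<Sum>E\<in>Q. ennreal \<bar>\<mu> E\<bar>) = (\<Sum>E\<in>P\<union>Q. ennreal \<bar>\<mu> E\<bar>)"
      using P(1) Q(1) signed_measure_empty[OF assms(1)]
      by (intro sum.union_inter_neutral[symmetric]) auto
    also have "\<dots> \<le> total_variation M \<mu> (A \<union> B)"
      unfolding total_variation_def
    proof (rule SUP_upper, safe)
      show "disjoint (P \<union> Q)" 
        using P Q assms(2) by (intro disjoint_union) auto
    qed (use P Q in auto)
    finally show ?thesis .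
  qed
  then have "(\<Sum>E\<in>P. ennreal \<bar>\<mu> E\<bar>) + total_variation M \<mu> B \<le> total_variation M \<mu> (A \<union> B)"
    if "P \<in> {P. finite P \<and> P \<subseteq> sets M \<and> disjoint P \<and> \<Union>P = A}" for P
    unfolding total_variation_def[of M \<mu> B] ennreal_SUP_add_right[OF ne[OF assms(4)]]
    using that by (intro SUP_least) blast
  then show ?thesis
    unfolding total_variation_def[of M \<mu> A] ennreal_SUP_add_left[OF ne[OF assms(3)], symmetric]
    by (rule SUP_least)
qed

lemma total_variation_mono:
  assumes "signed_measure M \<mu>" "A \<subseteq> B" "A \<in> sets M" "B \<in> sets M"
  shows "total_variation M \<mu> A \<le> total_variation M \<mu> B"
proof -
  have "total_variation M \<mu> A + 0 \<le> total_variation M \<mu> A + total_variation M \<mu> (B - A)"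
    by (intro add_left_mono) auto
  also have "\<dots> \<le> total_variation M \<mu> (A \<union> (B - A))"
    using assms by (intro total_variation_superadd) auto
  finally show ?thesis using assms by (simp add: Un_absorb1)
qed

text \<open>One inequality is superadditivity on finite unions, followed by monotonicity. For the
  other, every member of a finite partition of the union is cut along the \<open>A i\<close>, and
  the finite sum is exchanged with the series.\<close>

lemma countably_additive_total_variation:
  assumes "signed_measure M \<mu>"
  shows "countably_additive (sets M) (total_variation M \<mu>)"
proof (rule countably_additiveI)
  fix A :: "nat \<Rightarrow> 'a set"
  assume A: "range A \<subseteq> sets M" "disjoint_family A" "(\<Union>i. A i) \<in> sets M"
  show "(\<Sum>i. total_variation M \<mu> (A i)) = total_variation M \<mu> (\<Union>i. A i)"
  proof (rule antisym)
    have "(\<Sum>i<n. total_variation M \<mu> (A i)) \<le> total_variation M \<mu> (\<Union>i<n. A i)" for n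
    proof (induction n)
      case (Suc n)
      have "(\<Sum>i<Suc n. total_variation M \<mu> (A i))
          \<le> total_variation M \<mu> (\<Union>i<n. A i) + total_variation M \<mu> (A n)"
        using Suc by (simp add: add_right_mono)
      also have "\<dots> \<le> total_variation M \<mu> ((\<Union>i<n. A i) \<union> A n)"
      proof (rule total_variation_superadd[OF assms])
        have "A i \<inter> A n = {}" if "i < n" for i
          using disjoint_family_onD[OF A(2), of i n] that by simp
        then show "(\<Union>i<n. A i) \<inter> A n = {}" by blast
      qed (use A(1) in auto)
      finally show ?case by (simp add: lessThan_Suc Un_commute)
    qed (simp add: total_variation_empty[OF assms])
    moreover have "total_variation M \<mu> (\<Union>i<n. A i) \<le> total_variation M \<mu> (\<Union>i. A i)" for n
      using A by (intro total_variation_mono[OF assms]) auto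
    ultimately show "(\<Sum>i. total_variation M \<mu> (A i)) \<le> total_variation M \<mu> (\<Union>i. A i)"
      by (meson suminf_le_const summableI order_trans)
  next
    have "(\<Sum>E\<in>P. ennreal \<bar>\<mu> E\<bar>) \<le> (\<Sum>i. total_variation M \<mu> (A i))"
      if P: "finite P" "P \<subseteq> sets M" "disjoint P" "\<Union>P = (\<Union>i. A i)" for P
    proof -
      have "(\<Sum>E\<in>P. ennreal \<bar>\<mu> E\<bar>) \<le> (\<Sum>E\<in>P. \<Sum>i. ennreal \<bar>\<mu> (E \<inter> A i)\<bar>)"
      proof (rule sum_mono)
        fix E assume E: "E \<in> P"
        have "(\<lambda>i. \<mu> (E \<inter> A i)) sums \<mu> (\<Union>i. E \<inter> A i)"
          using A E P(2) by (intro signed_measure_sums[OF assms]) (auto simp: disjoint_family_on_def)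
        moreover have "(\<Union>i. E \<inter> A i) = E" using P(4) E by auto
        ultimately show "ennreal \<bar>\<mu> E\<bar> \<le> (\<Sum>i. ennreal \<bar>\<mu> (E \<inter> A i)\<bar>)"
          using ennreal_abs_sums_le by fastforce
      qed
      also have "\<dots> = (\<Sum>i. \<Sum>E\<in>P. ennreal \<bar>\<mu> (E \<inter> A i)\<bar>)"
        by (rule suminf_sum[symmetric]) auto
      also have "\<dots> \<le> (\<Sum>i. total_variation M \<mu> (A i))"
      proof (intro suminf_le summableI)
        fix i
        have "(\<Union>E\<in>P. E \<inter> A i) = A i" using P(4) by auto
        moreover have "disjoint_family_on (\<lambda>E. E \<inter> A i) P"
          using P(3) by (auto simp: disjoint_family_on_def disjoint_def)
        moreover have "E \<inter> A i \<in> sets M" if "E \<in> P" for E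
          using that P(2) A(1) by blast
        ultimately show "(\<Sum>E\<in>P. ennreal \<bar>\<mu> (E \<inter> A i)\<bar>) \<le> total_variation M \<mu> (A i)"
          using sum_le_total_variation[OF assms P(1), of "\<lambda>E. E \<inter> A i"] by simp
      qed
      finally show ?thesis .
    qed
    then show "total_variation M \<mu> (\<Union>i. A i) \<le> (\<Sum>i. total_variation M \<mu> (A i))"
      unfolding total_variation_def[of M \<mu> "\<Union>i. A i"] by (intro SUP_least) auto
  qed
qed

text \<open>In a partition with a large sum, the members of nonnegative or those of negative value
  unite to a set \<open>S\<close> with
  \<open>\<bar>\<mu> A\<bar> + 1 \<le> \<bar>\<mu> S\<bar>\<close>. Then \<open>S\<close> and
  \<open>A - S\<close> both have value at least 1 in modulus. One of them has infinite variation and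
  becomes \<open>B\<close>; the other is split off.\<close>

lemma infinite_total_variation_step:
  assumes \<mu>: "signed_measure M \<mu>" and A: "A \<in> sets M" "total_variation M \<mu> A = \<infinity>"
  shows "\<exists>B. B \<in> sets M \<and> B \<subseteq> A \<and> total_variation M \<mu> B = \<infinity> \<and> 1 \<le> \<bar>\<mu> (A - B)\<bar>"
proof -
  \<comment> \<open>The factor 2 is there because only the better of the two sign classes is
    kept.\<close>
  have "ennreal (2 * (\<bar>\<mu> A\<bar> + 1)) < total_variation M \<mu> A" using A by simp
  then obtain P where P: "finite P" "P \<subseteq> sets M" "disjoint P" "\<Union>P = A"
    and big: "ennreal (2 * (\<bar>\<mu> A\<bar> + 1)) < (\<Sum>E\<in>P. ennreal \<bar>\<mu> E\<bar>)"
    unfolding total_variation_def less_SUP_iff by auto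
  define Pp Pn where "Pp = {E \<in> P. 0 \<le> \<mu> E}" and "Pn = {E \<in> P. \<mu> E < 0}"
  have mu_Union: "\<mu> (\<Union>Q) = (\<Sum>E\<in>Q. \<mu> E)" "\<Union>Q \<in> sets M" "\<Union>Q \<subseteq> A" if "Q \<subseteq> P" for Q
  proof -
    show "\<mu> (\<Union>Q) = (\<Sum>E\<in>Q. \<mu> E)"
      using signed_measure_UN_finite[OF \<mu>, of Q "\<lambda>E. E"] that P finite_subset[OF that P(1)]
      by (auto simp: disjoint_family_on_def disjoint_def subset_eq)
    show "\<Union>Q \<in> sets M" using that P finite_subset[OF that P(1)] by auto
    show "\<Union>Q \<subseteq> A" using that P by auto
  qed
  have "2 * (\<bar>\<mu> A\<bar> + 1) < (\<Sum>E\<in>P. \<bar>\<mu> E\<bar>)"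
    using big by (subst (asm) sum_ennreal) (auto simp: ennreal_less_iff simp del: ennreal_plus)
  also have "\<dots> = (\<Sum>E\<in>Pp. \<bar>\<mu> E\<bar>) + (\<Sum>E\<in>Pn. \<bar>\<mu> E\<bar>)"
    using P(1) by (subst sum.union_disjoint[symmetric]) (auto simp: Pp_def Pn_def intro!: sum.cong)
  also have "\<dots> = \<bar>\<mu> (\<Union>Pp)\<bar> + \<bar>\<mu> (\<Union>Pn)\<bar>"
  proof -
    have "(\<Sum>E\<in>Pp. \<bar>\<mu> E\<bar>) = (\<Sum>E\<in>Pp. \<mu> E)" "(\<Sum>E\<in>Pn. \<bar>\<mu> E\<bar>) = - (\<Sum>E\<in>Pn. \<mu> E)"
      by (auto simp: Pp_def Pn_def sum_negf[symmetric] intro!: sum.cong)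
    moreover have "\<mu> (\<Union>Pp) = (\<Sum>E\<in>Pp. \<mu> E)" "\<mu> (\<Union>Pn) = (\<Sum>E\<in>Pn. \<mu> E)"
      by (intro mu_Union; auto simp: Pp_def Pn_def)+
    moreover have "(\<Sum>E\<in>Pp. \<mu> E) \<ge> 0" "(\<Sum>E\<in>Pn. \<mu> E) \<le> 0"
      by (auto simp: Pp_def Pn_def intro!: sum_nonneg sum_nonpos)
    ultimately show ?thesis by linarith
  qed
  finally have "2 * (\<bar>\<mu> A\<bar> + 1) < \<bar>\<mu> (\<Union>Pp)\<bar> + \<bar>\<mu> (\<Union>Pn)\<bar>" .
  moreover have "x \<le> y \<or> x \<le> z" if "2 * x < y + z" for x y z :: real
    using that by linarith
  ultimately have "\<bar>\<mu> A\<bar> + 1 \<le> \<bar>\<mu> (\<Union>Pp)\<bar> \<or> \<bar>\<mu> A\<bar> + 1 \<le> \<bar>\<mu> (\<Union>Pn)\<bar>" by blast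
  then obtain S where S: "S \<in> sets M" "S \<subseteq> A" "\<bar>\<mu> A\<bar> + 1 \<le> \<bar>\<mu> S\<bar>"
    using mu_Union(2,3)[of Pp] mu_Union(2,3)[of Pn] by (auto simp: Pp_def Pn_def)
  have D: "\<mu> (A - S) = \<mu> A - \<mu> S" using signed_measure_Diff[OF \<mu> A(1) S(1,2)] .
  have "total_variation M \<mu> A = total_variation M \<mu> S + total_variation M \<mu> (A - S)"
    using additiveD[OF sets.countably_additive_additive[OF _ countably_additive_total_variation[OF \<mu>]],
        of S "A - S"] S A total_variation_empty[OF \<mu>]
    by (simp add: positive_def Un_absorb1)
  then consider "total_variation M \<mu> S = \<infinity>" | "total_variation M \<mu> (A - S) = \<infinity>"
    using A(2) by (metis ennreal_add_eq_top infinity_ennreal_def)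
  then show ?thesis
  proof cases
    case 1
    then show ?thesis using S D by (intro exI[of _ S]) auto
  next
    case 2
    then show ?thesis using S A D by (intro exI[of _ "A - S"]) (auto simp: double_diff)
  qed
qed

text \<open>Otherwise the preceding step could be repeated for ever. The sets split off are
  disjoint, so their values form a convergent series, yet none of them is below 1 in
  modulus.\<close>

lemma total_variation_finite:
  assumes \<mu>: "signed_measure M \<mu>" and A: "A \<in> sets M"
  shows "total_variation M \<mu> A < \<infinity>"
proof (rule ccontr)
  assume "\<not> total_variation M \<mu> A < \<infinity>"
  then have inf: "total_variation M \<mu> A = \<infinity>" by (simp add: less_top[symmetric])
  obtain B :: "nat \<Rightarrow> 'a set" where B: "\<And>n. B n \<in> sets M \<and> total_variation M \<mu> (B n) = \<infinity>"
    and step: "\<And>n. B (Suc n) \<subseteq> B n \<and> 1 \<le> \<bar>\<mu> (B n - B (Suc n))\<bar>"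
    using dependent_nat_choice[of "\<lambda>_ B. B \<in> sets M \<and> total_variation M \<mu> B = \<infinity>"
        "\<lambda>_ B C. C \<subseteq> B \<and> 1 \<le> \<bar>\<mu> (B - C)\<bar>"] A inf infinite_total_variation_step[OF \<mu>]
    by metis
  have anti: "B n \<subseteq> B m" if "m \<le> n" for m n
    using lift_Suc_antimono_le[of B m n] step that by auto
  have "disjoint_family (\<lambda>n. B n - B (Suc n))"
    unfolding disjoint_family_on_def
  proof safe
    fix m n x assume "m \<noteq> n" "x \<in> B m" "x \<notin> B (Suc m)" "x \<in> B n" "x \<notin> B (Suc n)"
    then show "x \<in> {}" using anti[of "Suc m" n] anti[of "Suc n" m] by (cases "m < n") auto
  qed
  then have "(\<lambda>n. \<mu> (B n - B (Suc n))) sums \<mu> (\<Union>n. B n - B (Suc n))"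
    using B by (intro signed_measure_sums[OF \<mu>]) auto
  then have "(\<lambda>n. \<mu> (B n - B (Suc n))) \<longlonglongrightarrow> 0"
    using sums_summable summable_LIMSEQ_zero by blast
  then obtain n where "\<bar>\<mu> (B n - B (Suc n))\<bar> < 1"
    using LIMSEQ_D[of _ 0 1] by force
  with step[of n] show False by linarith
qed

section \<open>The total variation as a finite measure\<close>

definition variation_measure :: "'a measure \<Rightarrow> ('a set \<Rightarrow> real) \<Rightarrow> 'a measure" where
  "variation_measure M \<mu> = measure_of (space M) (sets M) (total_variation M \<mu>)"

lemma sets_variation_measure [simp]: "sets (variation_measure M \<mu>) = sets M"
  and space_variation_measure [simp]: "space (variation_measure M \<mu>) = space M"
  by (auto simp: variation_measure_def)

text \<open>\<open>measure_of\<close> falls back to the value 0 unless it is given a countably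
  additive set function; \<open>countably_additive_total_variation\<close> excludes this
  default.\<close>

lemma emeasure_variation_measure:
  assumes "signed_measure M \<mu>" "A \<in> sets M"
  shows "emeasure (variation_measure M \<mu>) A = total_variation M \<mu> A"
  unfolding variation_measure_def
  by (rule emeasure_measure_of_sigma)
    (use assms countably_additive_total_variation total_variation_empty in
      \<open>auto simp: positive_def sets.sigma_algebra_axioms\<close>)

lemma finite_variation_measure:
  assumes "signed_measure M \<mu>"
  shows "finite_measure (variation_measure M \<mu>)"
  using total_variation_finite[OF assms, of "space M"] emeasure_variation_measure[OF assms, of "space M"]
  by (intro finite_measureI) auto

lemma abs_le_variation_measure:
  assumes "signed_measure M \<mu>" "A \<in> sets M"
  shows "\<bar>\<mu> A\<bar> \<le> measure (variation_measure M \<mu>) A"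
proof -
  interpret finite_measure "variation_measure M \<mu>" by (rule finite_variation_measure[OF assms(1)])
  show ?thesis
    using abs_le_total_variation[OF assms] emeasure_variation_measure[OF assms]
    by (simp add: emeasure_eq_measure flip: ennreal_le_iff[OF measure_nonneg])
qed

text \<open>Extension by zero, which moves a signed measure from the interval to the whole
  line.\<close>

lemma signed_measure_restrict_space:
  assumes "signed_measure (restrict_space M S) \<mu>" "S \<in> sets M"
  shows "signed_measure M (\<lambda>A. \<mu> (A \<inter> S))"
  unfolding signed_measure_def
proof safe
  fix A :: "nat \<Rightarrow> 'a set" assume A: "range A \<subseteq> sets M" "disjoint_family A"
  have "(\<lambda>i. \<mu> (A i \<inter> S)) sums \<mu> (\<Union>i. A i \<inter> S)"
    using A assms(2) by (intro signed_measure_sums[OF assms(1)])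
      (auto simp: sets_restrict_space_iff disjoint_family_on_def)
  then show "(\<lambda>i. \<mu> (A i \<inter> S)) sums \<mu> ((\<Union> (range A)) \<inter> S)" by simp
qed

lemma total_variation_restrict_space:
  assumes "S \<in> sets M" "A \<subseteq> S"
  shows "total_variation (restrict_space M S) \<mu> A = total_variation M (\<lambda>A. \<mu> (A \<inter> S)) A"
  unfolding total_variation_def
proof (rule SUP_cong)
  show "{P. finite P \<and> P \<subseteq> sets (restrict_space M S) \<and> disjoint P \<and> \<Union>P = A}
      = {P. finite P \<and> P \<subseteq> sets M \<and> disjoint P \<and> \<Union>P = A}"
    using assms by (auto simp: sets_restrict_space_iff subset_iff)
next
  fix P assume "P \<in> {P. finite P \<and> P \<subseteq> sets M \<and> disjoint P \<and> \<Union>P = A}"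
  then have "E \<inter> S = E" if "E \<in> P" for E using that assms by auto
  then show "(\<Sum>E\<in>P. ennreal \<bar>\<mu> E\<bar>) = (\<Sum>E\<in>P. ennreal \<bar>\<mu> (E \<inter> S)\<bar>)" by simp
qed

lemma total_variation_cong:
  assumes "\<And>E. E \<in> sets M \<Longrightarrow> E \<subseteq> A \<Longrightarrow> \<mu> E = \<nu> E"
  shows "total_variation M \<mu> A = total_variation M \<nu> A"
  unfolding total_variation_def
proof (rule SUP_cong)
  fix P assume "P \<in> {P. finite P \<and> P \<subseteq> sets M \<and> disjoint P \<and> \<Union>P = A}"
  then have "\<mu> E = \<nu> E" if "E \<in> P" for E using that by (intro assms) auto
  then show "(\<Sum>E\<in>P. ennreal \<bar>\<mu> E\<bar>) = (\<Sum>E\<in>P. ennreal \<bar>\<nu> E\<bar>)" by (intro sum.cong) auto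
qed simp

lemma total_variation_eq_0:
  assumes "\<And>E. E \<in> sets M \<Longrightarrow> E \<subseteq> A \<Longrightarrow> \<mu> E = 0"
  shows "total_variation M \<mu> A = 0"
proof -
  have "total_variation M \<mu> A = total_variation M (\<lambda>_. 0) A"
    by (rule total_variation_cong) (rule assms)
  also have "\<dots> \<le> 0" unfolding total_variation_def by (intro SUP_least) simp
  finally show ?thesis by simp
qed

lemma total_variation_Un:
  assumes "signed_measure M \<mu>" "A \<in> sets M" "B \<in> sets M" "A \<inter> B = {}"
  shows "total_variation M \<mu> (A \<union> B) = total_variation M \<mu> A + total_variation M \<mu> B"
  using plus_emeasure[of A "variation_measure M \<mu>" B] assms
  by (simp add: emeasure_variation_measure)

lemma eq_0_of_total_variation_eq_0:
  assumes "signed_measure M \<mu>" "total_variation M \<mu> A = 0" "A \<in> sets M" "E \<in> sets M" "E \<subseteq> A"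
  shows "\<mu> E = 0"
proof -
  have "ennreal \<bar>\<mu> E\<bar> \<le> total_variation M \<mu> E" by (rule abs_le_total_variation) fact+
  also have "\<dots> \<le> 0" using total_variation_mono[of M \<mu> E A] assms by simp
  finally show ?thesis by simp
qed

section \<open>Integrals\<close>

text \<open>The infima over tails increase, so the sum of their suprema is the supremum of their
  sums.\<close>

lemma liminf_superadd_ennreal:
  fixes f g :: "nat \<Rightarrow> ennreal"
  shows "liminf f + liminf g \<le> liminf (\<lambda>n. f n + g n)"
proof -
  have inc: "incseq (\<lambda>n. INF m\<in>{n..}. h m)" for h :: "nat \<Rightarrow> ennreal"
    by (auto intro!: incseq_SucI INF_superset_mono)
  have "liminf f + liminf g = (SUP n. (INF m\<in>{n..}. f m) + (INF m\<in>{n..}. g m))"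
    unfolding liminf_SUP_INF by (rule ennreal_SUP_add[symmetric]) (intro inc)+
  also have "\<dots> \<le> (SUP n. INF m\<in>{n..}. f m + g m)"
    by (intro SUP_mono' INF_greatest add_mono INF_lower) auto
  finally show ?thesis by (simp add: liminf_SUP_INF)
qed

section \<open>Differentiation of integrals almost everywhere\<close>

lemma integral_right_derivative_off_negligible:
  fixes g :: "real \<Rightarrow> real"
  assumes "g integrable_on UNIV"
  obtains N where "negligible N"
    "\<And>x e. x \<notin> N \<Longrightarrow> 0 < e \<Longrightarrow>
      \<exists>\<delta>>0. \<forall>h. 0 \<le> h \<and> h < \<delta> \<longrightarrow> \<bar>integral {x..x + h} g - h * g x\<bar> \<le> e * h"
proof -
  have "g integrable_on cbox a b" for a b
    using assms integrable_on_subcbox by blast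
  then obtain N where N: "negligible N" and
    deriv: "\<And>x e. \<lbrakk>x \<notin> N; 0 < e\<rbrakk> \<Longrightarrow> \<exists>\<delta>>0. \<forall>h. 0 < h \<and> h < \<delta> \<longrightarrow>
      norm (integral (cbox x (x + h *\<^sub>R One)) g /\<^sub>R h ^ DIM(real) - g x) < e"
    using integrable_ccontinuous_explicit[of g] by metis
  show ?thesis
  proof (rule that[OF N])
    fix x e :: real assume "x \<notin> N" "0 < e"
    then obtain \<delta> where \<delta>: "\<delta> > 0" "\<And>h. 0 < h \<Longrightarrow> h < \<delta> \<Longrightarrow> \<bar>integral {x..x + h} g / h - g x\<bar> < e"
      using deriv[of x e] by (auto simp: divide_inverse mult.commute)
    \<comment> \<open>Cleared of the division by \<open>h\<close>, the estimate includes the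
      degenerate interval \<open>h = 0\<close>, which occurs below when the point is an endpoint of
      its interval.\<close>
    have "\<bar>integral {x..x + h} g - h * g x\<bar> \<le> e * h" if "0 \<le> h" "h < \<delta>" for h
    proof (cases "h = 0")
      case False
      then have "\<bar>integral {x..x + h} g - h * g x\<bar> = \<bar>integral {x..x + h} g / h - g x\<bar> * h"
        using that by (simp add: abs_mult_pos' field_simps flip: abs_mult_pos)
      also have "\<dots> \<le> e * h"
        using \<delta>(2)[of h] that False by (intro mult_right_mono) auto
      finally show ?thesis .
    qed simp
    then show "\<exists>\<delta>>0. \<forall>h. 0 \<le> h \<and> h < \<delta> \<longrightarrow> \<bar>integral {x..x + h} g - h * g x\<bar> \<le> e * h"
      using \<delta>(1) by blast
  qed
qed

text \<open>An interval around \<open>x\<close> is split at \<open>x\<close>. The right half is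
  covered by the preceding lemma for \<open>g\<close>, the left half by the same lemma for the
  reflected function, whose exceptional set is reflected back.\<close>

lemma integral_derivative_off_negligible:
  fixes g :: "real \<Rightarrow> real"
  assumes "integrable lborel g"
  obtains N where "negligible N"
    "\<And>x e. x \<notin> N \<Longrightarrow> 0 < e \<Longrightarrow>
      \<exists>\<delta>>0. \<forall>u v. u \<le> x \<and> x \<le> v \<and> v - u < \<delta> \<longrightarrow> \<bar>integral {u..v} g - (v - u) * g x\<bar> \<le> e * (v - u)"
proof -
  have g: "g integrable_on UNIV" using assms by (rule integrable_on_lborel)
  obtain N1 where N1: "negligible N1"
    "\<And>x e. x \<notin> N1 \<Longrightarrow> 0 < e \<Longrightarrow>
      \<exists>\<delta>>0. \<forall>h. 0 \<le> h \<and> h < \<delta> \<longrightarrow> \<bar>integral {x..x + h} g - h * g x\<bar> \<le> e * h"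
    using integral_right_derivative_off_negligible[OF g] by metis
  have "integrable lborel (\<lambda>x. g (- x))"
    using lborel_integrable_real_affine[OF assms, of "-1" 0] by simp
  then have "(\<lambda>x. g (- x)) integrable_on UNIV"
    by (rule integrable_on_lborel)
  then obtain N2 where N2: "negligible N2"
    "\<And>x e. x \<notin> N2 \<Longrightarrow> 0 < e \<Longrightarrow>
      \<exists>\<delta>>0. \<forall>h. 0 \<le> h \<and> h < \<delta> \<longrightarrow> \<bar>integral {x..x + h} (\<lambda>x. g (- x)) - h * g (- x)\<bar> \<le> e * h"
    using integral_right_derivative_off_negligible[of "\<lambda>x. g (- x)"] by metis
  have "negligible (N1 \<union> uminus ` N2)"
    using N1(1) N2(1) by (intro negligible_Un negligible_differentiable_image_negligible)
      (auto intro!: derivative_intros)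
  then show ?thesis
  proof (rule that)
    fix x e :: real assume x: "x \<notin> N1 \<union> uminus ` N2" and e: "0 < e"
    then have "x \<notin> N1" "- x \<notin> N2" by (auto simp: image_iff)
    then obtain \<delta>1 \<delta>2 where \<delta>: "\<delta>1 > 0" "\<delta>2 > 0"
      and r: "\<And>h. 0 \<le> h \<Longrightarrow> h < \<delta>1 \<Longrightarrow> \<bar>integral {x..x + h} g - h * g x\<bar> \<le> e * h"
      and l: "\<And>h. 0 \<le> h \<Longrightarrow> h < \<delta>2 \<Longrightarrow> \<bar>integral {- x..- x + h} (\<lambda>x. g (- x)) - h * g x\<bar> \<le> e * h"
      using N1(2)[of x e] N2(2)[of "- x" e] e by auto
    show "\<exists>\<delta>>0. \<forall>u v. u \<le> x \<and> x \<le> v \<and> v - u < \<delta> \<longrightarrow>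
        \<bar>integral {u..v} g - (v - u) * g x\<bar> \<le> e * (v - u)"
    proof (intro exI[of _ "min \<delta>1 \<delta>2"] conjI allI impI)
      fix u v assume uv: "u \<le> x \<and> x \<le> v \<and> v - u < min \<delta>1 \<delta>2"
      have "integral {u..v} g = integral {u..x} g + integral {x..v} g"
        using uv g integrable_on_subinterval[of g UNIV u v]
        by (intro Henstock_Kurzweil_Integration.integral_combine[symmetric]) auto
      moreover have "integral {- x..- x + (x - u)} (\<lambda>x. g (- x)) = integral {u..x} g"
        using integral_reflect_real[of x u g] by simp
      moreover have "\<bar>integral {x..x + (v - x)} g - (v - x) * g x\<bar> \<le> e * (v - x)"
        using uv by (intro r) auto
      moreover have "\<bar>integral {- x..- x + (x - u)} (\<lambda>x. g (- x)) - (x - u) * g x\<bar> \<le> e * (x - u)"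
        using uv by (intro l) auto
      moreover have "(v - u) * g x = (v - x) * g x + (x - u) * g x" "e * (v - u) = e * (v - x) + e * (x - u)"
        by (auto simp: algebra_simps)
      ultimately show "\<bar>integral {u..v} g - (v - u) * g x\<bar> \<le> e * (v - u)" by simp
    qed (use \<delta> in auto)
  qed
qed


text \<open>The tangent to \<open>y powr q\<close> at \<open>s\<close> lies below the curve, and
  integrating it over \<open>A\<close> gives the claim. In this form \<open>s\<close> is merely a
  lower bound for the mean of \<open>w\<close>, and the integrals may be infinite.\<close>

lemma jensen_powr_nn_integral:
  fixes w :: "real \<Rightarrow> real"
  assumes [measurable]: "w \<in> borel_measurable borel" "A \<in> sets borel"
    and w: "\<And>x. 0 \<le> w x" and A: "emeasure lborel A < \<infinity>" and "1 < q" "0 \<le> s"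
    and s: "ennreal (s * measure lborel A) \<le> (\<integral>\<^sup>+x\<in>A. ennreal (w x) \<partial>lborel)"
  shows "ennreal (s powr q * measure lborel A) \<le> (\<integral>\<^sup>+x\<in>A. ennreal (w x powr q) \<partial>lborel)"
proof (cases "s = 0")
  case True
  then show ?thesis by simp
next
  case False
  then have "0 < s" using assms by simp
  let ?m = "measure lborel A"
  have em: "emeasure lborel A = ennreal ?m" using A by (simp add: emeasure_eq_ennreal_measure top.not_eq_extremum)
  have tangent: "q * s powr (q - 1) * y \<le> y powr q + (q - 1) * s powr q" if "0 \<le> y" for y
  proof -
    \<comment> \<open>Young's inequality with the conjugate exponents \<open>q\<close> and
      \<open>q / (q - 1)\<close>; multiplied by \<open>q\<close> it is the tangent
      inequality.\<close>
    have "y * s powr (q - 1) \<le> y powr q / q + (s powr (q - 1)) powr (q / (q - 1)) / (q / (q - 1))"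
      using \<open>1 < q\<close> that by (intro Youngs_inequality) (auto simp: field_simps)
    also have "(s powr (q - 1)) powr (q / (q - 1)) = s powr q"
      using \<open>1 < q\<close> by (simp add: powr_powr)
    finally have "q * (y * s powr (q - 1)) \<le> q * (y powr q / q + s powr q / (q / (q - 1)))"
      using \<open>1 < q\<close> by (intro mult_left_mono) auto
    also have "\<dots> = y powr q + (q - 1) * s powr q"
      using \<open>1 < q\<close> by (simp add: field_simps)
    finally show ?thesis by (simp add: mult_ac)
  qed
  have sq: "s powr q = s powr (q - 1) * s" using \<open>0 < s\<close> by (simp add: powr_diff)
  have "ennreal (q * s powr q * ?m) = ennreal (q * s powr (q - 1)) * ennreal (s * ?m)"
    using \<open>1 < q\<close> \<open>0 < s\<close> by (subst ennreal_mult[symmetric]) (auto simp: sq mult_ac)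
  also have "\<dots> \<le> ennreal (q * s powr (q - 1)) * (\<integral>\<^sup>+x\<in>A. ennreal (w x) \<partial>lborel)"
    by (intro mult_left_mono s) auto
  also have "\<dots> = (\<integral>\<^sup>+x\<in>A. ennreal (q * s powr (q - 1) * w x) \<partial>lborel)"
    using \<open>1 < q\<close> w by (subst nn_integral_cmult[symmetric]) (auto simp: ennreal_mult mult_ac intro!: nn_integral_cong)
  also have "\<dots> \<le> (\<integral>\<^sup>+x. ennreal (w x powr q) * indicator A x + ennreal ((q - 1) * s powr q) * indicator A x \<partial>lborel)"
    using tangent w \<open>1 < q\<close>
    by (intro nn_integral_mono) (auto simp: indicator_def intro!: ennreal_leI simp flip: ennreal_plus)
  also have "\<dots> = (\<integral>\<^sup>+x\<in>A. ennreal (w x powr q) \<partial>lborel) + ennreal ((q - 1) * s powr q * ?m)"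
    using \<open>1 < q\<close> by (subst nn_integral_add) (auto simp: nn_integral_cmult_indicator em ennreal_mult'')
  finally have le: "ennreal (q * s powr q * ?m)
      \<le> ennreal ((q - 1) * s powr q * ?m) + (\<integral>\<^sup>+x\<in>A. ennreal (w x powr q) \<partial>lborel)"
    by (subst add.commute)
  \<comment> \<open>The summand \<open>(q - 1) * s powr q * ?m\<close> is finite, so it may be
    cancelled from both sides in [0, \<infinity>].\<close>
  have "q * s powr q * ?m = (q - 1) * s powr q * ?m + s powr q * ?m" by (simp add: algebra_simps)
  moreover have "ennreal ((q - 1) * s powr q * ?m + s powr q * ?m)
      = ennreal ((q - 1) * s powr q * ?m) + ennreal (s powr q * ?m)"
    using \<open>1 < q\<close> by (intro ennreal_plus) auto
  ultimately show ?thesis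
    using le ennreal_add_left_cancel_le[of "ennreal ((q - 1) * s powr q * ?m)"] by simp
qed

lemma abs_set_integral_eq_nn_integral:
  assumes g: "set_integrable M A (g :: _ \<Rightarrow> real)" and s: "\<bar>s\<bar> = 1" "\<And>x. x \<in> A \<Longrightarrow> \<bar>g x\<bar> = s * g x"
  shows "ennreal \<bar>LINT x:A|M. g x\<bar> = (\<integral>\<^sup>+x\<in>A. ennreal \<bar>g x\<bar> \<partial>M)"
proof -
  have "(LINT x:A|M. \<bar>g x\<bar>) = (LINT x:A|M. s * g x)"
    unfolding set_lebesgue_integral_def
    using s(2) by (intro Bochner_Integration.integral_cong) (auto simp: indicator_def)
  also have "\<dots> = s * (LINT x:A|M. g x)" by simp
  finally have *: "(LINT x:A|M. \<bar>g x\<bar>) = s * (LINT x:A|M. g x)" .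
  have "0 \<le> (LINT x:A|M. \<bar>g x\<bar>)"
    unfolding set_lebesgue_integral_def by (intro Bochner_Integration.integral_nonneg) auto
  then have "\<bar>LINT x:A|M. g x\<bar> = (LINT x:A|M. \<bar>g x\<bar>)"
    using * s(1) by (metis abs_mult abs_of_nonneg mult_1)
  moreover have "ennreal (LINT x:A|M. \<bar>g x\<bar>) = (\<integral>\<^sup>+x. ennreal (indicator A x * \<bar>g x\<bar>) \<partial>M)"
    unfolding set_lebesgue_integral_def
    using set_integrable_abs[OF g] unfolding set_integrable_def
    by (subst nn_integral_eq_integral) auto
  moreover have "(\<integral>\<^sup>+x. ennreal (indicator A x * \<bar>g x\<bar>) \<partial>M) = (\<integral>\<^sup>+x\<in>A. ennreal \<bar>g x\<bar> \<partial>M)"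
    by (intro nn_integral_cong) (auto simp: indicator_def)
  ultimately show ?thesis by simp
qed

text \<open>Each integral is a value of the measure with density \<open>w\<close>, so finite
  additivity and monotonicity of measures suffice.\<close>

lemma sum_set_nn_integral_le:
  assumes w[measurable]: "w \<in> borel_measurable M" and J: "finite J" "disjoint_family_on B J"
    and B: "\<And>j. j \<in> J \<Longrightarrow> B j \<in> sets M" and A: "A \<in> sets M" "(\<Union>j\<in>J. B j) \<subseteq> A"
  shows "(\<Sum>j\<in>J. \<integral>\<^sup>+x\<in>B j. w x \<partial>M) \<le> (\<integral>\<^sup>+x\<in>A. w x \<partial>M)"
proof -
  have "(\<Sum>j\<in>J. \<integral>\<^sup>+x\<in>B j. w x \<partial>M) = (\<Sum>j\<in>J. emeasure (density M w) (B j))"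
    using B by (intro sum.cong) (auto simp: emeasure_density)
  also have "\<dots> = emeasure (density M w) (\<Union>j\<in>J. B j)"
    using J B by (intro sum_emeasure) auto
  also have "\<dots> \<le> emeasure (density M w) A"
    using A by (intro emeasure_mono) auto
  also have "\<dots> = (\<integral>\<^sup>+x\<in>A. w x \<partial>M)"
    using A by (simp add: emeasure_density)
  finally show ?thesis .
qed

lemma abs_set_integral_le_nn_integral:
  assumes "set_integrable M A (g :: _ \<Rightarrow> real)"
  shows "ennreal \<bar>LINT x:A|M. g x\<bar> \<le> (\<integral>\<^sup>+x\<in>A. ennreal \<bar>g x\<bar> \<partial>M)"
proof -
  have "ennreal \<bar>LINT x:A|M. g x\<bar> \<le> (\<integral>\<^sup>+x. ennreal (norm (indicator A x *\<^sub>R g x)) \<partial>M)"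
    using integral_norm_bound_ennreal[OF assms[unfolded set_integrable_def]]
    by (simp add: set_lebesgue_integral_def)
  also have "\<dots> = (\<integral>\<^sup>+x\<in>A. ennreal \<bar>g x\<bar> \<partial>M)"
    by (intro nn_integral_cong) (auto simp: indicator_def)
  finally show ?thesis .
qed

section \<open>Interval partitions\<close>

text \<open>Dropping the right endpoint makes the intervals of a partition disjoint, and the
  increment of \<open>f\<close> over \<open>K\<close> is, up to sign, the value of \<open>Df\<close>
  on \<open>half_open K\<close>.\<close>

definition half_open :: "real set \<Rightarrow> real set" where
  "half_open K = {Inf K..<Sup K}"

lemma half_open_Icc: "u \<le> v \<Longrightarrow> half_open {u..v} = {u..<v}"
  by (simp add: half_open_def)

lemma half_open_borel [measurable]: "half_open K \<in> sets borel"
  by (simp add: half_open_def)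

lemma interval_partitionE:
  assumes "interval_partition {c..d} P" "K \<in> P"
  obtains u v where "K = {u..v}" "c \<le> u" "u < v" "v \<le> d"
proof -
  have div: "P division_of {c..d}" and int: "interior K \<noteq> {}"
    using assms by (auto simp: interval_partition_def)
  obtain u v where K: "K = cbox u v" using division_ofD(4)[OF div assms(2)] by blast
  then have "u < v" using int by (auto simp: interior_cbox)
  moreover have "K \<subseteq> {c..d}" using division_ofD(2)[OF div assms(2)] .
  ultimately show ?thesis using K by (intro that[of u v]) auto
qed

lemma disjoint_half_open:
  assumes P: "interval_partition {c..d} P"
  shows "disjoint_family_on half_open P"
  unfolding disjoint_family_on_def
proof (intro ballI impI)
  fix K L assume KL: "K \<in> P" "L \<in> P" "K \<noteq> L"
  obtain u v where uv: "K = {u..v}" "u < v" using interval_partitionE[OF P KL(1)] by metis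
  obtain r s where rs: "L = {r..s}" "r < s" using interval_partitionE[OF P KL(2)] by metis
  have "interior K \<inter> interior L = {}"
    using division_ofD(5)[of P "{c..d}" K L] P KL by (simp add: interval_partition_def)
  then have "{max u r<..<min v s} = {}"
    unfolding uv rs interior_atLeastAtMost_real by auto
  then have "min v s \<le> max u r" by (simp add: greaterThanLessThan_empty_iff)
  then show "half_open K \<inter> half_open L = {}"
    using uv rs by (auto simp: half_open_Icc)
qed

lemma UN_half_open_subset:
  assumes "interval_partition {c..d} P"
  shows "(\<Union>K\<in>P. half_open K) \<subseteq> {c..<d}"
proof
  fix x assume "x \<in> (\<Union>K\<in>P. half_open K)"
  then obtain K where K: "K \<in> P" "x \<in> half_open K" by blast
  obtain u v where "K = {u..v}" "c \<le> u" "u < v" "v \<le> d"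
    using interval_partitionE[OF assms K(1)] .
  then show "x \<in> {c..<d}" using K(2) by (simp add: half_open_Icc)
qed

section \<open>Uniform partitions and their cells\<close>

definition grid :: "real \<Rightarrow> real \<Rightarrow> nat \<Rightarrow> nat \<Rightarrow> real" where
  "grid c d n k = c + real k * ((d - c) / real n)"

definition cell :: "real \<Rightarrow> real \<Rightarrow> nat \<Rightarrow> nat \<Rightarrow> real set" where
  "cell c d n k = {grid c d n k..<grid c d n (Suc k)}"

definition uniform_partition :: "real \<Rightarrow> real \<Rightarrow> nat \<Rightarrow> real set set" where
  "uniform_partition c d n = (\<lambda>k. {grid c d n k..grid c d n (Suc k)}) ` {..<n}"

definition cells_meeting :: "real \<Rightarrow> real \<Rightarrow> nat \<Rightarrow> real set \<Rightarrow> nat set" where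
  "cells_meeting c d n C = {k. k < n \<and> cell c d n k \<inter> C \<noteq> {}}"

lemma grid_0 [simp]: "grid c d n 0 = c"
  by (simp add: grid_def)

lemma grid_last [simp]: "0 < n \<Longrightarrow> grid c d n n = d"
  by (simp add: grid_def)

lemma grid_Suc: "grid c d n (Suc k) = grid c d n k + (d - c) / real n"
proof -
  have "real (Suc k) * h = real k * h + h" for h by (simp add: distrib_right)
  from this[of "(d - c) / real n"] show ?thesis unfolding grid_def by linarith
qed

lemma grid_mono: "c < d \<Longrightarrow> i \<le> j \<Longrightarrow> grid c d n i \<le> grid c d n j"
  unfolding grid_def by (intro add_left_mono mult_right_mono) auto

lemma grid_less: "c < d \<Longrightarrow> 0 < n \<Longrightarrow> i < j \<Longrightarrow> grid c d n i < grid c d n j"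
  unfolding grid_def by (intro add_strict_left_mono mult_strict_right_mono) auto

lemma grid_in:
  assumes "c < d" "k \<le> n" "0 < n"
  shows "c \<le> grid c d n k" "grid c d n k \<le> d"
  using grid_mono[OF assms(1), of 0 k n] grid_mono[OF assms(1), of k n n] assms by auto

lemma cell_subset: "c < d \<Longrightarrow> k < n \<Longrightarrow> cell c d n k \<subseteq> {c..<d}"
  using grid_in[of c d k n] grid_in[of c d "Suc k" n] by (auto simp: cell_def)

lemma in_cell_unique:
  assumes "c < d" "0 < n" "x \<in> cell c d n i" "x \<in> cell c d n j"
  shows "i = j"
proof (rule ccontr)
  assume "i \<noteq> j"
  then show False
    using assms grid_mono[OF assms(1), of "Suc i" j n] grid_mono[OF assms(1), of "Suc j" i n]
    by (cases "i < j") (auto simp: cell_def)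
qed

lemma disjoint_cells: "c < d \<Longrightarrow> disjoint_family_on (cell c d n) {..<n}"
  using in_cell_unique[of c d n] by (fastforce simp: disjoint_family_on_def)

lemma in_some_cell:
  assumes "c < d" "0 < n" "x \<in> {c..<d}"
  obtains k where "k < n" "x \<in> cell c d n k"
proof -
  define h where "h = (d - c) / real n"
  have h: "h > 0" "real n * h = d - c" using assms by (auto simp: h_def)
  define k where "k = nat \<lfloor>(x - c) / h\<rfloor>"
  have "0 \<le> (x - c) / h" using assms h by simp
  then have "real k \<le> (x - c) / h" "(x - c) / h < real k + 1"
    unfolding k_def by linarith+
  then have *: "real k * h \<le> x - c" "x - c < (real k + 1) * h"
    using h(1) by (simp_all add: field_simps)
  then have "x \<in> cell c d n k"
    by (simp add: cell_def grid_def h_def[symmetric] add.commute)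
  moreover have "real k * h < real n * h" using * h(2) assms(3) by simp
  then have "k < n" using h(1) by simp
  ultimately show ?thesis using that by blast
qed

lemma cells_meeting_subset: "cells_meeting c d n C \<subseteq> {..<n}"
  by (auto simp: cells_meeting_def)

lemma finite_cells_meeting [simp]: "finite (cells_meeting c d n C)"
  by (rule finite_subset[OF cells_meeting_subset]) simp

lemma subset_UN_cells_meeting:
  assumes "c < d" "0 < n" "C \<subseteq> {c..<d}"
  shows "C \<subseteq> (\<Union>k\<in>cells_meeting c d n C. cell c d n k)"
proof
  fix x assume "x \<in> C"
  then obtain k where "k < n" "x \<in> cell c d n k" using in_some_cell[of c d n x] assms by blast
  with \<open>x \<in> C\<close> show "x \<in> (\<Union>k\<in>cells_meeting c d n C. cell c d n k)"
    by (auto simp: cells_meeting_def)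
qed

lemma inj_on_uniform:
  "c < d \<Longrightarrow> inj_on (\<lambda>k. {grid c d n k..grid c d n (Suc k)}) {..<n}"
proof (rule inj_onI)
  fix i j assume "c < d" and ij: "i \<in> {..<n}" "j \<in> {..<n}"
    and eq: "{grid c d n i..grid c d n (Suc i)} = {grid c d n j..grid c d n (Suc j)}"
  have n: "0 < n" using ij by auto
  have "grid c d n i = grid c d n j"
    using eq grid_mono[OF \<open>c < d\<close>, of i "Suc i" n] grid_mono[OF \<open>c < d\<close>, of j "Suc j" n]
    by (simp add: Icc_eq_Icc)
  then show "i = j" using grid_less[OF \<open>c < d\<close> n, of i j] grid_less[OF \<open>c < d\<close> n, of j i]
    by (metis less_irrefl linorder_neqE_nat)
qed

lemma interval_partition_uniform:
  assumes "c < d" "0 < n"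
  shows "interval_partition {c..d} (uniform_partition c d n)"
  unfolding interval_partition_def
proof
  show "uniform_partition c d n division_of {c..d}"
  proof (rule division_ofI)
    fix K assume "K \<in> uniform_partition c d n"
    then obtain k where k: "k < n" "K = {grid c d n k..grid c d n (Suc k)}"
      by (auto simp: uniform_partition_def)
    show "K \<subseteq> {c..d}"
      using k assms grid_in[OF assms(1) _ assms(2), of k] grid_in[OF assms(1) _ assms(2), of "Suc k"] by auto
    show "K \<noteq> {}" "\<exists>a b. K = cbox a b"
      using k assms grid_mono[OF assms(1), of k "Suc k" n] by (auto simp flip: box_real)
  next
    fix K L assume "K \<in> uniform_partition c d n" "L \<in> uniform_partition c d n" "K \<noteq> L"
    then obtain i j where ij: "i < n" "K = {grid c d n i..grid c d n (Suc i)}"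
        "j < n" "L = {grid c d n j..grid c d n (Suc j)}" "i \<noteq> j"
      by (auto simp: uniform_partition_def)
    have "interior K \<inter> interior L \<subseteq> cell c d n i \<inter> cell c d n j"
      unfolding ij(2,4) cell_def interior_atLeastAtMost_real by auto
    then show "interior K \<inter> interior L = {}"
      using in_cell_unique[OF assms, of _ i j] ij(5) by blast
  next
    have "{c..d} \<subseteq> \<Union> (uniform_partition c d n)"
    proof
      fix x assume x: "x \<in> {c..d}"
      show "x \<in> \<Union> (uniform_partition c d n)"
      proof (cases "x = d")
        case True
        have "d \<in> {grid c d n (n - 1)..grid c d n (Suc (n - 1))}"
          using assms grid_in[OF assms(1) _ assms(2), of "n - 1"] by simp
        moreover have "n - 1 < n" using assms(2) by simp
        ultimately show ?thesis unfolding True uniform_partition_def by blast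
      next
        case False
        then obtain k where "k < n" "x \<in> cell c d n k" using in_some_cell[OF assms, of x] x by auto
        then show ?thesis by (fastforce simp: uniform_partition_def cell_def)
      qed
    qed
    moreover have "\<Union> (uniform_partition c d n) \<subseteq> {c..d}"
    proof
      fix x assume "x \<in> \<Union> (uniform_partition c d n)"
      then obtain k where "k < n" "grid c d n k \<le> x" "x \<le> grid c d n (Suc k)"
        by (auto simp: uniform_partition_def)
      then show "x \<in> {c..d}"
        using grid_in(1)[OF assms(1) _ assms(2), of k] grid_in(2)[OF assms(1) _ assms(2), of "Suc k"]
        by simp
    qed
    ultimately show "\<Union> (uniform_partition c d n) = {c..d}" by blast
  qed (simp add: uniform_partition_def)
  show "\<forall>K\<in>uniform_partition c d n. interior K \<noteq> {}"
    using grid_less[OF assms lessI] by (simp add: uniform_partition_def interior_atLeastAtMost_real not_le)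
qed

lemma measure_grid:
  "c < d \<Longrightarrow> measure lborel {grid c d n k..grid c d n (Suc k)} = (d - c) / real n"
  using grid_mono[of c d k "Suc k" n] by (simp add: grid_Suc)

lemma mesh_uniform:
  assumes "c < d" "0 < n"
  shows "mesh (uniform_partition c d n) = (d - c) / real n"
proof -
  have "measure lborel ` uniform_partition c d n = {(d - c) / real n}"
    unfolding uniform_partition_def image_image measure_grid[OF assms(1)] using assms(2) by auto
  then show ?thesis by (simp add: mesh_def)
qed

lemma riesz_sum_uniform:
  assumes "c < d" "0 < n"
  shows "riesz_sum \<phi> f (uniform_partition c d n)
    = (\<Sum>k<n. phi_plus \<phi> {grid c d n k..grid c d n (Suc k)}
        (\<bar>f (grid c d n (Suc k)) - f (grid c d n k)\<bar> / ((d - c) / real n)) * ennreal ((d - c) / real n))"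
proof -
  have "increment f {grid c d n k..grid c d n (Suc k)} = f (grid c d n k) - f (grid c d n (Suc k))" for k
    using grid_mono[OF assms(1), of k "Suc k" n] by (simp add: increment_def)
  then show ?thesis
    unfolding riesz_sum_def uniform_partition_def sum.reindex[OF inj_on_uniform[OF assms(1)]] comp_def
      measure_grid[OF assms(1)]
    by (simp add: abs_minus_commute)
qed

lemma mesh_uniform_tendsto: "(\<lambda>n. (d - c) / real n) \<longlonglongrightarrow> 0"
  by (rule lim_const_over_n)

lemma eventually_riesz_sum_uniform_le:
  assumes "c < d" "0 < \<delta>"
  shows "\<forall>\<^sub>F n in sequentially. riesz_sum \<phi> f (uniform_partition c d n) \<le> riesz_sup \<phi> {c..d} f \<delta>"
proof -
  have "\<forall>\<^sub>F n in sequentially. (d - c) / real n < \<delta>"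
    using order_tendstoD(2)[OF mesh_uniform_tendsto assms(2)] .
  then show ?thesis
    using eventually_gt_at_top[of 0]
  proof eventually_elim
    case (elim n)
    then show ?case
      unfolding riesz_sup_def
      using interval_partition_uniform[OF assms(1)] mesh_uniform[OF assms(1)]
      by (intro SUP_upper) auto
  qed
qed

text \<open>Uniform partitions eventually have mesh below any given \<open>\<delta>\<close>, so
  their sums enter every supremum \<open>riesz_sup\<close>. This reduces lower bounds to uniform
  partitions.\<close>

lemma liminf_uniform_le_upper_variation:
  assumes "c < d"
  shows "liminf (\<lambda>n. riesz_sum \<phi> f (uniform_partition c d n)) \<le> upper_variation \<phi> {c..d} f"
  unfolding upper_variation_eq_INF
proof (rule INF_greatest)
  fix \<delta> :: real assume "\<delta> \<in> {0<..}"
  then have "liminf (\<lambda>n. riesz_sum \<phi> f (uniform_partition c d n))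
      \<le> liminf (\<lambda>n. riesz_sup \<phi> {c..d} f \<delta>)"
    by (intro Liminf_mono eventually_riesz_sum_uniform_le[OF assms]) auto
  then show "liminf (\<lambda>n. riesz_sum \<phi> f (uniform_partition c d n)) \<le> riesz_sup \<phi> {c..d} f \<delta>"
    by (simp add: Liminf_const)
qed

text \<open>The cells that meet \<open>C\<close> stay in closed neighbourhoods of \<open>C\<close>
  which decrease to \<open>C\<close>, and a finite measure is continuous from above. The measure
  \<open>M\<close> is kept general because the lemma serves both the total variation and Lebesgue
  measure on the interval.\<close>

lemma eventually_cells_meeting_close:
  fixes C :: "real set"
  assumes "c < d" "compact C" "finite_measure M" "sets M = sets borel" "0 < \<epsilon>"
  shows "\<forall>\<^sub>F n in sequentially. measure M ((\<Union>k\<in>cells_meeting c d n C. cell c d n k) - C) < \<epsilon>"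
\<comment> \<open>The empty set is treated apart because \<open>infdist x {}\<close> is 0, which
  would put every point close to it.\<close>
proof (cases "C = {}")
  case True
  then show ?thesis using assms by (simp add: cells_meeting_def)
next
  case False
  interpret finite_measure M by fact
  \<comment> \<open>\<open>Suc n\<close> avoids the radius \<open>(d - c) / 0 = 0\<close> at the
    start, with which \<open>W\<close> would not be decreasing.\<close>
  define W where "W n = {x. infdist x C \<le> (d - c) / real (Suc n)}" for n
  have W_sets: "W n \<in> sets M" for n
    unfolding W_def assms(4)
    by (intro borel_closed closed_Collect_le continuous_intros)
  have C_sets: "C \<in> sets M" using assms by (auto intro: borel_compact)
  have "decseq W"
    unfolding decseq_def
  proof (intro allI impI subsetI)
    fix m n x assume "m \<le> n" "x \<in> W n"
    moreover have "(d - c) / real (Suc n) \<le> (d - c) / real (Suc m)"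
      using assms(1) \<open>m \<le> n\<close> by (intro divide_left_mono) auto
    ultimately show "x \<in> W m" unfolding W_def by simp
  qed
  then have "(\<lambda>n. measure M (W n)) \<longlonglongrightarrow> measure M (\<Inter>n. W n)"
    using W_sets by (intro finite_Lim_measure_decseq) auto
  moreover have "(\<Inter>n. W n) = C"
  proof
    show "(\<Inter>n. W n) \<subseteq> C"
    proof
      fix x assume x: "x \<in> (\<Inter>n. W n)"
      then have "infdist x C \<le> (d - c) / real (Suc n)" for n by (auto simp: W_def)
      then have "infdist x C \<le> 0"
        by (intro LIMSEQ_le_const[OF LIMSEQ_Suc[OF mesh_uniform_tendsto[of d c]]]) auto
      then show "x \<in> C"
        using in_closed_iff_infdist_zero[OF compact_imp_closed[OF assms(2)] False, of x]
          infdist_nonneg[of x C] by linarith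
    qed
    show "C \<subseteq> (\<Inter>n. W n)" using assms(1) by (auto simp: W_def)
  qed
  ultimately have "(\<lambda>n. measure M (W n)) \<longlonglongrightarrow> measure M C" by simp
  then have "\<forall>\<^sub>F n in sequentially. measure M (W n) < measure M C + \<epsilon>"
    by (rule order_tendstoD) (use assms in simp)
  then have "\<forall>\<^sub>F n in sequentially. measure M (W n - C) < \<epsilon>"
  proof eventually_elim
    case (elim n)
    have "C \<subseteq> W n" using assms(1) by (auto simp: W_def)
    then have "measure M (W n - C) = measure M (W n) - measure M C"
      using W_sets C_sets by (intro finite_measure_Diff)
    then show ?case using elim by simp
  qed
  then have "\<forall>\<^sub>F n in sequentially. measure M ((\<Union>k\<in>cells_meeting c d (Suc n) C. cell c d (Suc n) k) - C) < \<epsilon>"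
  proof eventually_elim
    case (elim n)
    have "(\<Union>k\<in>cells_meeting c d (Suc n) C. cell c d (Suc n) k) \<subseteq> W n"
    proof safe
      fix k x assume "k \<in> cells_meeting c d (Suc n) C" and x: "x \<in> cell c d (Suc n) k"
      then obtain y where y: "y \<in> C" "y \<in> cell c d (Suc n) k" by (auto simp: cells_meeting_def)
      have "infdist x C \<le> dist x y" by (rule infdist_le[OF y(1)])
      also have "\<dots> \<le> (d - c) / real (Suc n)"
        using x y(2) unfolding cell_def dist_real_def grid_Suc atLeastLessThan_iff by linarith
      finally show "x \<in> W n" by (simp add: W_def)
    qed
    then have "measure M ((\<Union>k\<in>cells_meeting c d (Suc n) C. cell c d (Suc n) k) - C) \<le> measure M (W n - C)"
      using W_sets C_sets by (intro finite_measure_mono) auto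
    then show ?case using elim by simp
  qed
  then show ?thesis by (rule eventually_sequentially_Suc[THEN iffD1])
qed

text \<open>Partition intervals lie in \<open>I\<close>, so only the values of \<open>\<phi>\<close>
  there enter. This permits a change of the coefficient outside the interval.\<close>

lemma upper_variation_cong:
  assumes "\<And>x t. x \<in> I \<Longrightarrow> \<phi> x t = \<psi> x t"
  shows "upper_variation \<phi> I f = upper_variation \<psi> I f"
proof -
  have "riesz_sum \<phi> f P = riesz_sum \<psi> f P" if "interval_partition I P" for P
    unfolding riesz_sum_def
  proof (rule sum.cong[OF refl])
    fix K assume "K \<in> P"
    then have "K \<subseteq> I" using that by (auto simp: interval_partition_def dest: division_ofD(2))
    then have "phi_plus \<phi> K t = phi_plus \<psi> K t" for t
      unfolding phi_plus_def using assms by (intro SUP_cong) auto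
    then show "phi_plus \<phi> K (\<bar>increment f K\<bar> / measure lborel K) * ennreal (measure lborel K)
        = phi_plus \<psi> K (\<bar>increment f K\<bar> / measure lborel K) * ennreal (measure lborel K)" by simp
  qed
  then have "riesz_sup \<phi> I f \<delta> = riesz_sup \<psi> I f \<delta>" for \<delta>
    unfolding riesz_sup_def by (intro SUP_cong) auto
  then show ?thesis by (simp add: upper_variation_eq_INF)
qed

section \<open>Increments and total variation\<close>

text \<open>In the application \<open>\<mu>\<close> is \<open>Df\<close> extended by zero to all
  Borel sets, and \<open>f_diff\<close> is the defining formula of \<open>Df\<close> with a general
  left endpoint in place of \<open>c\<close>.\<close>

locale derivative_measure =
  fixes c d :: real and f :: "real \<Rightarrow> real" and \<mu> :: "real set \<Rightarrow> real"
  assumes cd: "c < d"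
    and \<mu>: "signed_measure borel \<mu>"
    and f_diff: "\<And>u v. c \<le> u \<Longrightarrow> u \<le> v \<Longrightarrow> v \<le> d \<Longrightarrow> f v - f u = \<mu> {u..<v}"
begin

abbreviation \<tau> :: "real measure" where
  "\<tau> \<equiv> variation_measure borel \<mu>"

sublocale \<tau>: finite_measure \<tau>
  by (rule finite_variation_measure[OF \<mu>])

lemma cell_sets [measurable]: "cell c d n k \<in> sets borel"
  by (simp add: cell_def)

lemma grid_increment:
  assumes "k < n"
  shows "f (grid c d n (Suc k)) - f (grid c d n k) = \<mu> (cell c d n k)"
  unfolding cell_def using assms grid_in[OF cd, of k n] grid_in[OF cd, of "Suc k" n] grid_mono[OF cd, of k "Suc k" n]
  by (intro f_diff) auto

text \<open>On the union of the cells that meet \<open>C\<close>, the value of \<open>\<mu>\<close>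
  is the sum of the increments. Passing from this union to \<open>C\<close> costs at most the
  variation of the excess, which \<open>eventually_cells_meeting_close\<close> makes small.\<close>

lemma abs_measure_compact_le:
  assumes C: "compact C" "C \<subseteq> {c..<d}" and "0 < n"
  shows "\<bar>\<mu> C\<bar> \<le> (\<Sum>k\<in>cells_meeting c d n C. \<bar>f (grid c d n (Suc k)) - f (grid c d n k)\<bar>)
    + measure \<tau> ((\<Union>k\<in>cells_meeting c d n C. cell c d n k) - C)"
proof -
  define U where "U = (\<Union>k\<in>cells_meeting c d n C. cell c d n k)"
  have CU: "C \<subseteq> U" unfolding U_def by (rule subset_UN_cells_meeting[OF cd assms(3) C(2)])
  have sets: "C \<in> sets borel" "U \<in> sets borel"
    using C(1) by (auto simp: U_def borel_compact intro!: sets.finite_UN)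
  have "\<mu> U = (\<Sum>k\<in>cells_meeting c d n C. \<mu> (cell c d n k))"
    unfolding U_def using disjoint_family_on_mono[OF cells_meeting_subset disjoint_cells[OF cd]]
    by (intro signed_measure_UN_finite[OF \<mu>]) auto
  also have "\<dots> = (\<Sum>k\<in>cells_meeting c d n C. f (grid c d n (Suc k)) - f (grid c d n k))"
    by (intro sum.cong grid_increment[symmetric]) (auto simp: cells_meeting_def)
  finally have "\<bar>\<mu> U\<bar> \<le> (\<Sum>k\<in>cells_meeting c d n C. \<bar>f (grid c d n (Suc k)) - f (grid c d n k)\<bar>)"
    by simp
  moreover have "\<bar>\<mu> (U - C)\<bar> \<le> measure \<tau> (U - C)"
    using sets by (intro abs_le_variation_measure[OF \<mu>]) auto
  moreover have "\<mu> (U - C) = \<mu> U - \<mu> C"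
    using signed_measure_Diff[OF \<mu> sets(2,1) CU] .
  ultimately show ?thesis unfolding U_def by linarith
qed

text \<open>The finite Borel measure \<open>\<tau>\<close> is inner regular, and it dominates the
  modulus of \<open>\<mu>\<close> on \<open>E - C\<close>.\<close>

lemma inner_regular_abs:
  assumes "E \<in> sets borel" "0 < \<eta>"
  shows "\<exists>C. compact C \<and> C \<subseteq> E \<and> \<bar>\<mu> E\<bar> < \<bar>\<mu> C\<bar> + \<eta>"
proof -
  have reg: "emeasure \<tau> E = (SUP K\<in>{K. K \<subseteq> E \<and> compact K}. emeasure \<tau> K)"
    using assms by (intro inner_regular) auto
  have "\<exists>C. compact C \<and> C \<subseteq> E \<and> measure \<tau> E < measure \<tau> C + \<eta>"
  \<comment> \<open>The case split keeps \<open>measure \<tau> E - \<eta>\<close> nonnegative, since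
    \<open>ennreal\<close> truncates negative numbers to 0.\<close>
  proof (cases "measure \<tau> E < \<eta>")
    case True
    then show ?thesis by (intro exI[of _ "{}"]) auto
  next
    case False
    then have "ennreal (measure \<tau> E - \<eta>) < emeasure \<tau> E"
      using assms by (simp add: \<tau>.emeasure_eq_measure ennreal_less_iff)
    then obtain K where "K \<subseteq> E" "compact K" "ennreal (measure \<tau> E - \<eta>) < emeasure \<tau> K"
      unfolding reg less_SUP_iff by auto
    then show ?thesis using False
      by (intro exI[of _ K]) (auto simp: \<tau>.emeasure_eq_measure ennreal_less_iff)
  qed
  then obtain C where C: "compact C" "C \<subseteq> E" "measure \<tau> E < measure \<tau> C + \<eta>" by blast
  have sets: "C \<in> sets borel" using C by (simp add: borel_compact)
  have "\<bar>\<mu> (E - C)\<bar> \<le> measure \<tau> (E - C)"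
    using sets assms by (intro abs_le_variation_measure[OF \<mu>]) auto
  also have "\<dots> = measure \<tau> E - measure \<tau> C"
    using sets assms C by (intro \<tau>.finite_measure_Diff) auto
  finally have "\<bar>\<mu> E\<bar> < \<bar>\<mu> C\<bar> + \<eta>"
    using signed_measure_Diff[OF \<mu> assms(1) sets C(2)] C(3) by linarith
  then show ?thesis using C by blast
qed

text \<open>Disjoint nonempty compact sets have positive distance, and a cell that meets both is at
  least that long.\<close>

lemma eventually_cells_meeting_disjoint:
  assumes "compact C" "compact D" "C \<inter> D = {}"
  shows "\<forall>\<^sub>F n in sequentially. cells_meeting c d n C \<inter> cells_meeting c d n D = {}"
proof (cases "C = {} \<or> D = {}")
  case True
  then show ?thesis by (auto simp: cells_meeting_def)
next
  case False
  then have "0 < setdist C D"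
    using assms by (simp add: setdist_gt_0_compact_closed compact_imp_closed)
  then have "\<forall>\<^sub>F n in sequentially. (d - c) / real n < setdist C D"
    using order_tendstoD(2)[OF mesh_uniform_tendsto] by blast
  then show ?thesis
  proof eventually_elim
    case (elim n)
    have False if k: "k \<in> cells_meeting c d n C" "k \<in> cells_meeting c d n D" for k
    proof -
      obtain x y where x: "x \<in> C" "x \<in> cell c d n k" and y: "y \<in> D" "y \<in> cell c d n k"
        using k by (auto simp: cells_meeting_def)
      have "setdist C D \<le> \<bar>x - y\<bar>"
        using setdist_le_dist[OF x(1) y(1)] by (simp add: dist_real_def)
      also have "\<dots> \<le> (d - c) / real n"
        using x(2) y(2) unfolding cell_def grid_Suc atLeastLessThan_iff by linarith
      finally show False using elim by simp
    qed
    then show ?case by blast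
  qed
qed

text \<open>Each \<open>E\<close> is replaced by a compact subset of nearly the same value.
  Eventually no cell meets two of these subsets, so every increment is counted at most once.\<close>

lemma eventually_sum_abs_le_sum_increments:
  assumes P: "finite P" "P \<subseteq> sets borel" "disjoint P" "\<Union>P \<subseteq> {c..<d}" and "0 < \<epsilon>"
  shows "\<forall>\<^sub>F n in sequentially.
    (\<Sum>E\<in>P. \<bar>\<mu> E\<bar>) \<le> (\<Sum>k<n. \<bar>f (grid c d n (Suc k)) - f (grid c d n k)\<bar>) + \<epsilon>"
proof -
  \<comment> \<open>Each \<open>E\<close> costs \<open>\<eta>\<close> for its compact subset and
    \<open>\<eta>\<close> for the excess of the cells; the \<open>+ 1\<close> covers an empty
    \<open>P\<close>.\<close>
  define \<eta> where "\<eta> = \<epsilon> / (2 * real (card P) + 1)"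
  have \<eta>: "0 < \<eta>" "2 * real (card P) * \<eta> \<le> \<epsilon>"
    using assms(5) by (auto simp: \<eta>_def field_simps)
  have "\<exists>C. compact C \<and> C \<subseteq> E \<and> \<bar>\<mu> E\<bar> < \<bar>\<mu> C\<bar> + \<eta>" if "E \<in> P" for E
    using that P(2) \<eta>(1) by (intro inner_regular_abs) auto
  then obtain K where K: "\<And>E. E \<in> P \<Longrightarrow> compact (K E) \<and> K E \<subseteq> E \<and> \<bar>\<mu> E\<bar> < \<bar>\<mu> (K E)\<bar> + \<eta>"
    by metis
  have "\<forall>\<^sub>F n in sequentially. \<forall>E\<in>P.
      measure \<tau> ((\<Union>k\<in>cells_meeting c d n (K E). cell c d n k) - K E) < \<eta>"
  proof (intro eventually_ball_finite[OF P(1)] ballI)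
    fix E assume "E \<in> P"
    then have "compact (K E)" using K by blast
    then show "\<forall>\<^sub>F n in sequentially. measure \<tau> ((\<Union>k\<in>cells_meeting c d n (K E). cell c d n k) - K E) < \<eta>"
      by (rule eventually_cells_meeting_close[OF cd _ \<tau>.finite_measure_axioms _ \<eta>(1)]) simp
  qed
  moreover have "\<forall>\<^sub>F n in sequentially. \<forall>E\<in>P. \<forall>F\<in>P. E \<noteq> F \<longrightarrow>
      cells_meeting c d n (K E) \<inter> cells_meeting c d n (K F) = {}"
  proof (intro eventually_ball_finite[OF P(1)] ballI)
    fix E F assume EF: "E \<in> P" "F \<in> P"
    show "\<forall>\<^sub>F n in sequentially. E \<noteq> F \<longrightarrow>
      cells_meeting c d n (K E) \<inter> cells_meeting c d n (K F) = {}"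
    proof (cases "E = F")
      case False
      then have "K E \<inter> K F = {}" using K[OF EF(1)] K[OF EF(2)] P(3) EF by (fastforce simp: disjoint_def)
      then show ?thesis
        using eventually_cells_meeting_disjoint[of "K E" "K F"] K EF by (auto elim: eventually_mono)
    qed simp
  qed
  ultimately show ?thesis
    using eventually_gt_at_top[of 0]
  proof eventually_elim
    case (elim n)
    let ?\<Delta> = "\<lambda>k. \<bar>f (grid c d n (Suc k)) - f (grid c d n k)\<bar>"
    have "(\<Sum>E\<in>P. \<bar>\<mu> E\<bar>) \<le> (\<Sum>E\<in>P. (\<Sum>k\<in>cells_meeting c d n (K E). ?\<Delta> k) + 2 * \<eta>)"
    proof (rule sum_mono)
      fix E assume E: "E \<in> P"
      have "K E \<subseteq> {c..<d}" using K[OF E] P(4) E by blast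
      then show "\<bar>\<mu> E\<bar> \<le> (\<Sum>k\<in>cells_meeting c d n (K E). ?\<Delta> k) + 2 * \<eta>"
        using abs_measure_compact_le[of "K E" n] K[OF E] elim(1,3) E by fastforce
    qed
    also have "\<dots> = (\<Sum>E\<in>P. \<Sum>k\<in>cells_meeting c d n (K E). ?\<Delta> k) + 2 * real (card P) * \<eta>"
      by (simp add: sum.distrib)
    also have "(\<Sum>E\<in>P. \<Sum>k\<in>cells_meeting c d n (K E). ?\<Delta> k)
        = (\<Sum>k\<in>(\<Union>E\<in>P. cells_meeting c d n (K E)). ?\<Delta> k)"
      using elim(2) by (intro sum.UNION_disjoint[symmetric] P(1)) auto
    also have "\<dots> \<le> (\<Sum>k<n. ?\<Delta> k)"
      by (intro sum_mono2) (auto simp: cells_meeting_def)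
    finally show ?case using \<eta>(2) by linarith
  qed
qed

lemma total_variation_le_liminf_increments:
  "total_variation borel \<mu> {c..<d}
    \<le> liminf (\<lambda>n. \<Sum>k<n. ennreal \<bar>f (grid c d n (Suc k)) - f (grid c d n k)\<bar>)"
  (is "_ \<le> ?L")
  unfolding total_variation_def
proof (rule SUP_least)
  fix P assume "P \<in> {P. finite P \<and> P \<subseteq> sets borel \<and> disjoint P \<and> \<Union>P = {c..<d}}"
  then have P: "finite P" "P \<subseteq> sets borel" "disjoint P" "\<Union>P \<subseteq> {c..<d}" by auto
  show "(\<Sum>E\<in>P. ennreal \<bar>\<mu> E\<bar>) \<le> ?L"
  proof (rule ennreal_le_epsilon)
    fix \<epsilon> :: real assume "0 < \<epsilon>"
    have "\<forall>\<^sub>F n in sequentially. (\<Sum>E\<in>P. ennreal \<bar>\<mu> E\<bar>)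
        \<le> (\<Sum>k<n. ennreal \<bar>f (grid c d n (Suc k)) - f (grid c d n k)\<bar>) + ennreal \<epsilon>"
      using eventually_sum_abs_le_sum_increments[OF P \<open>0 < \<epsilon>\<close>]
      by eventually_elim (use \<open>0 < \<epsilon>\<close> in \<open>simp add: sum_nonneg ennreal_leI flip: ennreal_plus\<close>)
    then have "(\<Sum>E\<in>P. ennreal \<bar>\<mu> E\<bar>)
        \<le> liminf (\<lambda>n. (\<Sum>k<n. ennreal \<bar>f (grid c d n (Suc k)) - f (grid c d n k)\<bar>) + ennreal \<epsilon>)"
      by (rule Liminf_bounded)
    also have "\<dots> = ?L + ennreal \<epsilon>" by (rule Liminf_add_const) simp
    finally show "(\<Sum>E\<in>P. ennreal \<bar>\<mu> E\<bar>) \<le> ?L + ennreal \<epsilon>" .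
  qed
qed

end

section \<open>The double phase functional\<close>

text \<open>All data live on the whole line: the theorem supplies measures extended by zero, a
  density cut off outside \<open>{c..d}\<close> and a coefficient clamped at the endpoints. The
  assumption \<open>\<nu>_d\<close> settles the point \<open>d\<close>, which belongs to no
  half-open cell.\<close>

locale double_phase_data = derivative_measure +
  fixes g :: "real \<Rightarrow> real" and \<nu> :: "real set \<Rightarrow> real" and N :: "real set"
    and a :: "real \<Rightarrow> real" and \<alpha> q H :: real
  assumes g: "integrable lborel g"
    and \<nu>: "signed_measure borel \<nu>"
    and N: "N \<in> null_sets lborel"
    and \<nu>_outside: "\<And>A. A \<in> sets borel \<Longrightarrow> A \<inter> N = {} \<Longrightarrow> \<nu> A = 0"
    and decomposition: "\<And>A. A \<in> sets borel \<Longrightarrow> \<mu> A = (LINT x:A|lborel. g x) + \<nu> A"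
    and \<nu>_d: "\<nu> {d} = 0"
    and a_nonneg: "\<And>x. 0 \<le> a x"
    and holder: "\<And>x y. \<bar>a x - a y\<bar> \<le> H * \<bar>x - y\<bar> powr \<alpha>"
    and H: "0 \<le> H" and \<alpha>: "0 < \<alpha>" and q: "1 < q" "q < 1 + \<alpha>"
begin

section \<open>Density part and singular part of the variation\<close>

lemma g_measurable [measurable]: "g \<in> borel_measurable borel"
  using borel_measurable_integrable[OF g] by simp

lemma set_integrable_g: "A \<in> sets borel \<Longrightarrow> set_integrable lborel A g"
  unfolding set_integrable_def using g by (intro integrable_mult_indicator) auto

lemma a_continuous: "continuous_on UNIV a"
proof (rule continuous_at_imp_continuous_on, safe)
  fix x
  have "((\<lambda>y. H * \<bar>y - x\<bar> powr \<alpha>) \<longlongrightarrow> H * \<bar>x - x\<bar> powr \<alpha>) (at x)"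
    using \<alpha> by (intro tendsto_mult tendsto_const tendsto_powr' tendsto_intros) auto
  then have "((\<lambda>y. H * \<bar>y - x\<bar> powr \<alpha>) \<longlongrightarrow> 0) (at x)" using \<alpha> by simp
  then have "((\<lambda>y. a y - a x) \<longlongrightarrow> 0) (at x)"
    by (rule Lim_null_comparison[rotated]) (use holder in auto)
  then show "isCont a x" unfolding isCont_def by (rule LIM_zero_cancel)
qed

lemma a_measurable [measurable]: "a \<in> borel_measurable borel"
  using borel_measurable_continuous_onI[OF a_continuous] .

lemma N_borel [measurable]: "N \<in> sets borel"
  using N by (auto simp: null_sets_def)

text \<open>Away from \<open>N\<close>, \<open>\<mu>\<close> has density \<open>g\<close>. The sign
  of \<open>g\<close> splits \<open>A\<close> into two pieces on each of which the modulus of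
  \<open>\<mu>\<close> is the integral of \<open>\<bar>g\<bar>\<close>.\<close>

lemma total_variation_absolutely_continuous_part:
  assumes A: "A \<in> sets borel" "A \<inter> N = {}"
  shows "(\<integral>\<^sup>+x\<in>A. ennreal \<bar>g x\<bar> \<partial>lborel) \<le> total_variation borel \<mu> A"
proof -
  define P Q where "P = {x \<in> A. 0 < g x}" and "Q = {x \<in> A. g x \<le> 0}"
  have "{x. 0 < g x} \<in> sets borel" "{x. g x \<le> 0} \<in> sets borel" by measurable
  then have sets [measurable]: "P \<in> sets borel" "Q \<in> sets borel"
    using A(1) by (auto simp: P_def Q_def Collect_conj_eq)
  have \<mu>_PQ: "\<mu> P = (LINT x:P|lborel. g x)" "\<mu> Q = (LINT x:Q|lborel. g x)"
    using decomposition[OF sets(1)] decomposition[OF sets(2)] \<nu>_outside[OF sets(1)] \<nu>_outside[OF sets(2)] A(2)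
    by (auto simp: P_def Q_def)
  have "(\<integral>\<^sup>+x\<in>A. ennreal \<bar>g x\<bar> \<partial>lborel) =
      (\<integral>\<^sup>+x. ennreal \<bar>g x\<bar> * indicator P x + ennreal \<bar>g x\<bar> * indicator Q x \<partial>lborel)"
    by (intro nn_integral_cong) (auto simp: P_def Q_def indicator_def)
  also have "\<dots> = (\<integral>\<^sup>+x\<in>P. ennreal \<bar>g x\<bar> \<partial>lborel) + (\<integral>\<^sup>+x\<in>Q. ennreal \<bar>g x\<bar> \<partial>lborel)"
    by (intro nn_integral_add) measurable
  also have "(\<integral>\<^sup>+x\<in>P. ennreal \<bar>g x\<bar> \<partial>lborel) = ennreal \<bar>\<mu> P\<bar>"
    unfolding \<mu>_PQ using set_integrable_g[OF sets(1)]
    by (intro abs_set_integral_eq_nn_integral[of _ _ _ 1, symmetric]) (auto simp: P_def)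
  also have "(\<integral>\<^sup>+x\<in>Q. ennreal \<bar>g x\<bar> \<partial>lborel) = ennreal \<bar>\<mu> Q\<bar>"
    unfolding \<mu>_PQ using set_integrable_g[OF sets(2)]
    by (intro abs_set_integral_eq_nn_integral[of _ _ _ "-1", symmetric]) (auto simp: Q_def)
  also have "ennreal \<bar>\<mu> P\<bar> + ennreal \<bar>\<mu> Q\<bar> \<le> total_variation borel \<mu> P + total_variation borel \<mu> Q"
    using sets by (intro add_mono abs_le_total_variation[OF \<mu>]) auto
  also have "\<dots> = total_variation borel \<mu> (P \<union> Q)"
    using sets by (intro total_variation_Un[OF \<mu>, symmetric]) (auto simp: P_def Q_def)
  also have "P \<union> Q = A" by (auto simp: P_def Q_def)
  finally show ?thesis .
qed

text \<open>Apart from the point \<open>d\<close>, which carries no mass, \<open>\<nu>\<close> lives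
  on \<open>N\<close>. Since \<open>N\<close> is Lebesgue null, the density contributes nothing
  there, so \<open>\<nu>\<close> and \<open>\<mu>\<close> agree on Borel subsets of
  \<open>{c..<d} \<inter> N\<close>.\<close>

lemma total_variation_singular_part:
  "total_variation borel \<nu> {c..d} = total_variation borel \<mu> ({c..<d} \<inter> N)"
proof -
  have "total_variation borel \<nu> ({c..d} - ({c..<d} \<inter> N)) = 0"
  proof (rule total_variation_eq_0)
    fix E assume E: "E \<in> sets borel" "E \<subseteq> {c..d} - ({c..<d} \<inter> N)"
    have "\<nu> (E - {d}) = 0" using E cd by (intro \<nu>_outside) auto
    moreover have "\<nu> (E \<inter> {d}) = 0"
      using \<nu>_d signed_measure_empty[OF \<nu>] by (cases "d \<in> E") auto
    moreover have "\<nu> ((E - {d}) \<union> (E \<inter> {d})) = \<nu> (E - {d}) + \<nu> (E \<inter> {d})"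
      using E by (intro signed_measure_Un[OF \<nu>]) auto
    ultimately show "\<nu> E = 0" by (simp add: Un_Diff_Int)
  qed
  moreover have "{c..d} = ({c..<d} \<inter> N) \<union> ({c..d} - ({c..<d} \<inter> N))" by auto
  moreover have "total_variation borel \<nu> (({c..<d} \<inter> N) \<union> ({c..d} - ({c..<d} \<inter> N)))
      = total_variation borel \<nu> ({c..<d} \<inter> N) + total_variation borel \<nu> ({c..d} - ({c..<d} \<inter> N))"
    by (intro total_variation_Un[OF \<nu>]) auto
  ultimately have "total_variation borel \<nu> {c..d} = total_variation borel \<nu> ({c..<d} \<inter> N)"
    by simp
  also have "\<dots> = total_variation borel \<mu> ({c..<d} \<inter> N)"
  proof (rule total_variation_cong)
    fix E assume E: "E \<in> sets borel" "E \<subseteq> {c..<d} \<inter> N"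
    have "E \<in> null_sets lborel" using E N by (auto intro: null_sets_subset)
    then have "(LINT x:E|lborel. g x) = 0"
      unfolding set_lebesgue_integral_def
      by (intro integral_eq_zero_AE AE_I'[of E]) (auto simp: indicator_def)
    then show "\<nu> E = \<mu> E" using decomposition[OF E(1)] by simp
  qed
  finally show ?thesis .
qed

lemma nn_integral_add_total_variation_le:
  "(\<integral>\<^sup>+x\<in>{c..d}. ennreal \<bar>g x\<bar> \<partial>lborel) + total_variation borel \<nu> {c..d}
    \<le> total_variation borel \<mu> {c..<d}"
proof -
  have "(\<integral>\<^sup>+x\<in>{c..d}. ennreal \<bar>g x\<bar> \<partial>lborel) = (\<integral>\<^sup>+x\<in>{c..<d} - N. ennreal \<bar>g x\<bar> \<partial>lborel)"
  proof (rule nn_integral_cong_AE, rule AE_I')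
    show "N \<union> {d} \<in> null_sets lborel" using N by (intro null_sets.Un) auto
  qed (auto simp: indicator_def)
  also have "\<dots> \<le> total_variation borel \<mu> ({c..<d} - N)"
    by (intro total_variation_absolutely_continuous_part) auto
  finally have "(\<integral>\<^sup>+x\<in>{c..d}. ennreal \<bar>g x\<bar> \<partial>lborel) + total_variation borel \<nu> {c..d}
      \<le> total_variation borel \<mu> ({c..<d} - N) + total_variation borel \<mu> ({c..<d} \<inter> N)"
    unfolding total_variation_singular_part by (rule add_right_mono)
  also have "\<dots> = total_variation borel \<mu> (({c..<d} - N) \<union> ({c..<d} \<inter> N))"
    by (intro total_variation_Un[OF \<mu>, symmetric]) auto
  also have "({c..<d} - N) \<union> ({c..<d} \<inter> N) = {c..<d}" by auto
  finally show ?thesis .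
qed

end

subsection \<open>Lower bound\<close>

context double_phase_data
begin

definition slope :: "nat \<Rightarrow> nat \<Rightarrow> real" where
  "slope n k = \<bar>f (grid c d n (Suc k)) - f (grid c d n k)\<bar> / ((d - c) / real n)"

lemma slope_nonneg: "0 \<le> slope n k"
  using cd by (simp add: slope_def)

lemma set_integral_half_open:
  "(LINT x:{u..<v}|lborel. g x) = integral {u..v} g"
proof -
  have "(LINT x:{u..<v}|lborel. g x) = integral {u..<v} g"
    by (intro set_borel_integral_eq_integral set_integrable_g) auto
  also have "\<dots> = integral {u..v} g"
  proof (rule integral_subset_negligible)
    have "{u..v} - {u..<v} \<subseteq> {v}" by auto
    then show "negligible ({u..v} - {u..<v})" by (rule negligible_subset[OF negligible_sing])
  qed auto
  finally show ?thesis .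
qed

context
  assumes sing: "total_variation borel \<nu> {x\<in>{c..d}. 0 < a x} = 0"
begin

lemma positive_set_borel: "{x\<in>{c..d}. 0 < a x} \<in> sets borel"
proof -
  have "{x. 0 < a x} \<in> sets borel" by measurable
  then show ?thesis by (simp add: Collect_conj_eq)
qed

text \<open>Vanishing variation of \<open>\<nu>\<close> on a set annihilates \<open>\<nu>\<close> on
  each Borel subset, so only the density remains.\<close>

lemma \<mu>_eq_integral:
  assumes "A \<in> sets borel" "A \<subseteq> {x\<in>{c..d}. 0 < a x}"
  shows "\<mu> A = (LINT x:A|lborel. g x)"
  using decomposition[OF assms(1)] eq_0_of_total_variation_eq_0[OF \<nu> sing positive_set_borel assms]
  by simp

text \<open>By continuity \<open>a\<close> is positive near \<open>x\<close>, so small cells around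
  \<open>x\<close> lie where \<open>\<mu>\<close> has density \<open>g\<close>. The increment is
  then the integral of \<open>g\<close>, to which the derivative estimate applies.\<close>

lemma eventually_slope_close:
  assumes deriv: "\<exists>\<delta>>0. \<forall>u v. u \<le> x \<and> x \<le> v \<and> v - u < \<delta> \<longrightarrow>
      \<bar>integral {u..v} g - (v - u) * g x\<bar> \<le> e * (v - u)"
    and x: "x \<in> {c..<d}" "0 < a x"
  shows "\<forall>\<^sub>F n in sequentially. \<forall>k<n. x \<in> cell c d n k \<longrightarrow> \<bar>slope n k - \<bar>g x\<bar>\<bar> \<le> e"
proof -
  obtain \<delta> where \<delta>: "0 < \<delta>" and close: "\<And>u v. u \<le> x \<Longrightarrow> x \<le> v \<Longrightarrow> v - u < \<delta> \<Longrightarrow>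
      \<bar>integral {u..v} g - (v - u) * g x\<bar> \<le> e * (v - u)"
    using deriv by blast
  have "isCont a x" using a_continuous by (simp add: continuous_on_eq_continuous_at)
  then have "\<forall>\<^sub>F y in at x. 0 < a y" unfolding isCont_def using x(2) by (rule order_tendstoD)
  then obtain \<rho> where \<rho>: "0 < \<rho>" "\<And>y. dist y x < \<rho> \<Longrightarrow> 0 < a y"
    using x(2) unfolding eventually_at by (metis UNIV_I)
  have "\<forall>\<^sub>F n in sequentially. (d - c) / real n < min \<delta> \<rho>"
    using \<delta> \<rho>(1) by (intro order_tendstoD(2)[OF mesh_uniform_tendsto]) auto
  then show ?thesis
    using eventually_gt_at_top[of 0]
  proof eventually_elim
    case (elim n)
    let ?h = "(d - c) / real n"
    have h: "0 < ?h" using cd elim by simp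
    show ?case
    proof (intro allI impI)
      fix k assume k: "k < n" "x \<in> cell c d n k"
      define u v where "u = grid c d n k" and "v = grid c d n (Suc k)"
      have uv: "u \<le> x" "x < v" "v - u = ?h"
        using k(2) by (auto simp: cell_def u_def v_def grid_Suc)
      have "cell c d n k \<subseteq> {x\<in>{c..d}. 0 < a x}"
      proof
        fix y assume y: "y \<in> cell c d n k"
        then have "u \<le> y" "y < v" by (auto simp: cell_def u_def v_def)
        then have "dist y x < \<rho>" using uv elim(1) by (auto simp: dist_real_def)
        then show "y \<in> {x\<in>{c..d}. 0 < a x}" using y \<rho>(2) cell_subset[OF cd k(1)] by auto
      qed
      then have "f v - f u = (LINT x:{u..<v}|lborel. g x)"
        unfolding u_def v_def grid_increment[OF k(1)] cell_def[symmetric]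
        by (intro \<mu>_eq_integral) auto
      also have "\<dots> = integral {u..v} g" by (rule set_integral_half_open)
      finally have "\<bar>(f v - f u) - ?h * g x\<bar> \<le> e * ?h"
        using close[of u v] uv elim(1) by simp
      then have "\<bar>\<bar>f v - f u\<bar> - ?h * \<bar>g x\<bar>\<bar> \<le> e * ?h"
        using abs_triangle_ineq3[of "f v - f u" "?h * g x"] h unfolding abs_mult[of ?h] by linarith
      moreover have "\<bar>f v - f u\<bar> - ?h * \<bar>g x\<bar> = (slope n k - \<bar>g x\<bar>) * ?h"
      proof -
        have "x / ?h * ?h = x" for x using h by (metis less_irrefl nonzero_eq_divide_eq)
        then show ?thesis by (simp only: slope_def u_def v_def left_diff_distrib mult.commute[of ?h])
      qed
      ultimately have "\<bar>slope n k - \<bar>g x\<bar>\<bar> * ?h \<le> e * ?h"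
        using h by (metis abs_mult abs_of_pos)
      then show "\<bar>slope n k - \<bar>g x\<bar>\<bar> \<le> e" using h by (simp only: mult_le_cancel_right_pos)
    qed
  qed
qed

text \<open>Exactly one cell contains \<open>x\<close>, so the sum has a single nonzero candidate,
  given by the slope over that cell. Where \<open>a x = 0\<close> the factor makes both sides
  vanish, however the slopes behave.\<close>

lemma tendsto_slope_powr:
  assumes deriv: "\<And>e. 0 < e \<Longrightarrow> \<exists>\<delta>>0. \<forall>u v. u \<le> x \<and> x \<le> v \<and> v - u < \<delta> \<longrightarrow>
      \<bar>integral {u..v} g - (v - u) * g x\<bar> \<le> e * (v - u)"
    and x: "x \<in> {c..<d}"
  shows "(\<lambda>n. \<Sum>k<n. ennreal (a x * slope n k powr q) * indicator (cell c d n k) x)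
    \<longlonglongrightarrow> ennreal (a x * \<bar>g x\<bar> powr q)"
proof (cases "a x = 0")
  case True
  then show ?thesis by simp
next
  case False
  then have ax: "0 < a x" using a_nonneg[of x] by simp
  have "\<forall>n. \<exists>k. 0 < n \<longrightarrow> k < n \<and> x \<in> cell c d n k"
    using in_some_cell[OF cd _ x] by metis
  then obtain \<kappa> where \<kappa>: "\<And>n. 0 < n \<Longrightarrow> \<kappa> n < n \<and> x \<in> cell c d n (\<kappa> n)" by metis
  have "(\<lambda>n. slope n (\<kappa> n)) \<longlonglongrightarrow> \<bar>g x\<bar>"
  proof (rule tendstoI)
    fix e :: real assume "0 < e"
    then have "\<forall>\<^sub>F n in sequentially. \<forall>k<n. x \<in> cell c d n k \<longrightarrow> \<bar>slope n k - \<bar>g x\<bar>\<bar> \<le> e / 2"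
      by (intro eventually_slope_close deriv x ax) auto
    then show "\<forall>\<^sub>F n in sequentially. dist (slope n (\<kappa> n)) \<bar>g x\<bar> < e"
      using eventually_gt_at_top[of 0]
    proof eventually_elim
      case (elim n)
      then have "\<bar>slope n (\<kappa> n) - \<bar>g x\<bar>\<bar> \<le> e / 2" using \<kappa> by blast
      then show ?case using \<open>0 < e\<close> by (simp add: dist_real_def)
    qed
  qed
  then have "(\<lambda>n. slope n (\<kappa> n) powr q) \<longlonglongrightarrow> \<bar>g x\<bar> powr q"
    using q(1) slope_nonneg by (intro tendsto_powr' tendsto_const) auto
  then have "(\<lambda>n. ennreal (a x * slope n (\<kappa> n) powr q)) \<longlonglongrightarrow> ennreal (a x * \<bar>g x\<bar> powr q)"
    by (intro tendsto_ennrealI tendsto_mult tendsto_const)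
  moreover have "\<forall>\<^sub>F n in sequentially. ennreal (a x * slope n (\<kappa> n) powr q)
      = (\<Sum>k<n. ennreal (a x * slope n k powr q) * indicator (cell c d n k) x)"
    using eventually_gt_at_top[of 0]
  proof eventually_elim
    case (elim n)
    have "(\<Sum>k<n. ennreal (a x * slope n k powr q) * indicator (cell c d n k) x)
        = (\<Sum>k\<in>{\<kappa> n}. ennreal (a x * slope n k powr q) * indicator (cell c d n k) x)"
      using \<kappa>[OF elim] in_cell_unique[OF cd elim, of x _ "\<kappa> n"]
      by (intro sum.mono_neutral_right) (auto simp: indicator_def)
    then show ?case using \<kappa>[OF elim] by simp
  qed
  ultimately show ?thesis by (rule Lim_transform_eventually)
qed

text \<open>Fatou's lemma for the step functions of the preceding lemma, which converge at almost
  every point of the interval.\<close>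

lemma nn_integral_le_liminf_slopes:
  "(\<integral>\<^sup>+x\<in>{c..d}. ennreal (a x * \<bar>g x\<bar> powr q) \<partial>lborel)
    \<le> liminf (\<lambda>n. \<Sum>k<n. \<integral>\<^sup>+x\<in>cell c d n k. ennreal (a x * slope n k powr q) \<partial>lborel)"
proof -
  let ?T = "\<lambda>n x. \<Sum>k<n. ennreal (a x * slope n k powr q) * indicator (cell c d n k) x"
  obtain Z where Z: "negligible Z" and deriv: "\<And>x e. x \<notin> Z \<Longrightarrow> 0 < e \<Longrightarrow>
      \<exists>\<delta>>0. \<forall>u v. u \<le> x \<and> x \<le> v \<and> v - u < \<delta> \<longrightarrow> \<bar>integral {u..v} g - (v - u) * g x\<bar> \<le> e * (v - u)"
    using integral_derivative_off_negligible[OF g] by metis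
  \<comment> \<open>Negligible means null for the completed measure; \<open>Z'\<close> is a Borel
    null set containing \<open>Z\<close>.\<close>
  obtain Z' where Z': "Z' \<in> null_sets lborel" "Z \<subseteq> Z'"
    using Z unfolding negligible_iff_null_sets null_sets_completion_iff2 by blast
  have "(\<integral>\<^sup>+x\<in>{c..d}. ennreal (a x * \<bar>g x\<bar> powr q) \<partial>lborel) \<le> (\<integral>\<^sup>+x. liminf (\<lambda>n. ?T n x) \<partial>lborel)"
  proof (rule nn_integral_mono_AE, rule AE_I')
    show "Z' \<union> {d} \<in> null_sets lborel" using Z' by (intro null_sets.Un) auto
    have "ennreal (a x * \<bar>g x\<bar> powr q) * indicator {c..d} x \<le> liminf (\<lambda>n. ?T n x)"
      if "x \<notin> Z' \<union> {d}" for x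
    proof (cases "x \<in> {c..<d}")
      case True
      have "(\<lambda>n. ?T n x) \<longlonglongrightarrow> ennreal (a x * \<bar>g x\<bar> powr q)"
        using that Z'(2) by (intro tendsto_slope_powr[OF _ True] deriv) auto
      then have "liminf (\<lambda>n. ?T n x) = ennreal (a x * \<bar>g x\<bar> powr q)"
        by (intro lim_imp_Liminf) auto
      then show ?thesis by (simp add: indicator_def)
    qed (use that in auto)
    then show "{x \<in> space lborel. \<not> ennreal (a x * \<bar>g x\<bar> powr q) * indicator {c..d} x
        \<le> liminf (\<lambda>n. ?T n x)} \<subseteq> Z' \<union> {d}" by blast
  qed
  also have "\<dots> \<le> liminf (\<lambda>n. \<integral>\<^sup>+x. ?T n x \<partial>lborel)"
    by (intro nn_integral_liminf) measurable
  also have "(\<lambda>n. \<integral>\<^sup>+x. ?T n x \<partial>lborel)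
      = (\<lambda>n. \<Sum>k<n. \<integral>\<^sup>+x\<in>cell c d n k. ennreal (a x * slope n k powr q) \<partial>lborel)"
    by (intro ext nn_integral_sum) measurable
  finally show ?thesis .
qed

end

lemma emeasure_cell:
  "emeasure lborel (cell c d n k) = ennreal ((d - c) / real n)"
  using grid_mono[OF cd, of k "Suc k" n] by (simp add: cell_def) (simp add: grid_Suc)

text \<open>The supremum \<open>phi_plus\<close> dominates \<open>double_phase a q x\<close> at each
  point \<open>x\<close> of the cell. Integrating this over the cell bounds the Riesz term from
  below, and the linear part integrates to the modulus of the increment.\<close>

lemma riesz_sum_uniform_ge:
  assumes n: "0 < n"
  shows "(\<Sum>k<n. ennreal \<bar>f (grid c d n (Suc k)) - f (grid c d n k)\<bar>)
      + (\<Sum>k<n. \<integral>\<^sup>+x\<in>cell c d n k. ennreal (a x * slope n k powr q) \<partial>lborel)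
    \<le> riesz_sum (double_phase a q) f (uniform_partition c d n)"
  unfolding riesz_sum_uniform[OF cd n] sum.distrib[symmetric]
proof (rule sum_mono)
  fix k assume "k \<in> {..<n}"
  let ?h = "(d - c) / real n" and ?t = "slope n k"
  let ?K = "{grid c d n k..grid c d n (Suc k)}"
  have h: "0 < ?h" using cd n by simp
  have "ennreal \<bar>f (grid c d n (Suc k)) - f (grid c d n k)\<bar> = ennreal ?t * ennreal ?h"
    using h cd n by (subst ennreal_mult[symmetric]) (auto simp: slope_def)
  also have "\<dots> = (\<integral>\<^sup>+x\<in>cell c d n k. ennreal ?t \<partial>lborel)"
    by (simp add: nn_integral_cmult_indicator emeasure_cell)
  finally have "ennreal \<bar>f (grid c d n (Suc k)) - f (grid c d n k)\<bar>
      + (\<integral>\<^sup>+x\<in>cell c d n k. ennreal (a x * ?t powr q) \<partial>lborel)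
    = (\<integral>\<^sup>+x\<in>cell c d n k. (ennreal ?t + ennreal (a x * ?t powr q)) \<partial>lborel)"
    by (simp add: nn_set_integral_add)
  also have "\<dots> \<le> (\<integral>\<^sup>+x\<in>cell c d n k. phi_plus (double_phase a q) ?K ?t \<partial>lborel)"
  proof (intro nn_integral_mono)
    fix x
    show "(ennreal ?t + ennreal (a x * ?t powr q)) * indicator (cell c d n k) x
        \<le> phi_plus (double_phase a q) ?K ?t * indicator (cell c d n k) x"
    proof (cases "x \<in> cell c d n k")
      case True
      then have "double_phase a q x ?t \<le> phi_plus (double_phase a q) ?K ?t"
        unfolding phi_plus_def by (intro SUP_upper) (auto simp: cell_def)
      moreover have "double_phase a q x ?t = ennreal ?t + ennreal (a x * ?t powr q)"
        unfolding double_phase_def using slope_nonneg a_nonneg by (intro ennreal_plus) auto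
      ultimately show ?thesis using True by simp
    qed simp
  qed
  also have "\<dots> = phi_plus (double_phase a q) ?K ?t * ennreal ?h"
    by (simp add: nn_integral_cmult_indicator emeasure_cell)
  finally show "ennreal \<bar>f (grid c d n (Suc k)) - f (grid c d n k)\<bar>
      + (\<integral>\<^sup>+x\<in>cell c d n k. ennreal (a x * ?t powr q) \<partial>lborel)
    \<le> phi_plus (double_phase a q) ?K
        (\<bar>f (grid c d n (Suc k)) - f (grid c d n k)\<bar> / ?h) * ennreal ?h"
    by (simp add: slope_def)
qed

text \<open>The linear part is bounded through the total variation and the \<open>q\<close>-part
  through Fatou; the two bounds can be added because both hold along the same partitions.\<close>

lemma upper_variation_ge:
  assumes sing: "total_variation borel \<nu> {x\<in>{c..d}. 0 < a x} = 0"
  shows "(\<integral>\<^sup>+x\<in>{c..d}. ennreal (\<bar>g x\<bar> + a x * \<bar>g x\<bar> powr q) \<partial>lborel) + total_variation borel \<nu> {c..d}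
    \<le> upper_variation (double_phase a q) {c..d} f"
proof -
  let ?S = "\<lambda>n. \<Sum>k<n. ennreal \<bar>f (grid c d n (Suc k)) - f (grid c d n k)\<bar>"
  let ?T = "\<lambda>n. \<Sum>k<n. \<integral>\<^sup>+x\<in>cell c d n k. ennreal (a x * slope n k powr q) \<partial>lborel"
  have "(\<integral>\<^sup>+x\<in>{c..d}. ennreal (\<bar>g x\<bar> + a x * \<bar>g x\<bar> powr q) \<partial>lborel)
      = (\<integral>\<^sup>+x\<in>{c..d}. (ennreal \<bar>g x\<bar> + ennreal (a x * \<bar>g x\<bar> powr q)) \<partial>lborel)"
    using a_nonneg by (intro nn_integral_cong) (simp add: ennreal_plus)
  also have "\<dots> = (\<integral>\<^sup>+x\<in>{c..d}. ennreal \<bar>g x\<bar> \<partial>lborel) + (\<integral>\<^sup>+x\<in>{c..d}. ennreal (a x * \<bar>g x\<bar> powr q) \<partial>lborel)"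
    by (intro nn_set_integral_add) measurable
  finally have "(\<integral>\<^sup>+x\<in>{c..d}. ennreal (\<bar>g x\<bar> + a x * \<bar>g x\<bar> powr q) \<partial>lborel) + total_variation borel \<nu> {c..d}
      = ((\<integral>\<^sup>+x\<in>{c..d}. ennreal \<bar>g x\<bar> \<partial>lborel) + total_variation borel \<nu> {c..d})
        + (\<integral>\<^sup>+x\<in>{c..d}. ennreal (a x * \<bar>g x\<bar> powr q) \<partial>lborel)"
    by (simp add: ac_simps)
  also have "\<dots> \<le> liminf ?S + liminf ?T"
    using order_trans[OF nn_integral_add_total_variation_le total_variation_le_liminf_increments]
      nn_integral_le_liminf_slopes[OF sing] by (intro add_mono)
  also have "\<dots> \<le> liminf (\<lambda>n. ?S n + ?T n)" by (rule liminf_superadd_ennreal)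
  also have "\<dots> \<le> liminf (\<lambda>n. riesz_sum (double_phase a q) f (uniform_partition c d n))"
    using riesz_sum_uniform_ge by (intro Liminf_mono eventually_mono[OF eventually_gt_at_top[of 0]])
  also have "\<dots> \<le> upper_variation (double_phase a q) {c..d} f"
    by (rule liminf_uniform_le_upper_variation[OF cd])
  finally show ?thesis .
qed

end

subsection \<open>Vanishing of the singular part\<close>

text \<open>If \<open>t\<close> exceeds \<open>L\<close>, then \<open>(t / L) powr (q - 1)\<close>
  is at least 1. Linear growth is traded for \<open>q\<close>-growth with a factor that vanishes as
  \<open>L\<close> tends to infinity.\<close>

lemma le_add_powr_div:
  fixes t :: real
  assumes "0 \<le> t" "0 < L" "1 < q"
  shows "t \<le> L + t powr q / L powr (q - 1)"
proof (cases "t \<le> L")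
  case True
  have "0 \<le> t powr q / L powr (q - 1)" by simp
  then show ?thesis using True by linarith
next
  case False
  then have "L powr (q - 1) \<le> t powr (q - 1)" using assms by (intro powr_mono2) auto
  then have "t * L powr (q - 1) \<le> t * t powr (q - 1)" using assms by (intro mult_left_mono) auto
  also have "\<dots> = t powr q" using False assms by (simp add: powr_diff)
  finally have "t \<le> t powr q / L powr (q - 1)" using assms by (simp add: field_simps)
  then show ?thesis using assms by linarith
qed

context double_phase_data
begin

text \<open>A cell that meets \<open>C\<close> contains a point with
  \<open>\<epsilon> \<le> a x\<close>, so its Riesz term is at least
  \<open>\<epsilon> * slope n k powr q\<close> times its length. The length-weighted
  \<open>q\<close>-powers of the slopes thus sum to at most \<open>S / \<epsilon>\<close>, and
  \<open>le_add_powr_div\<close> turns this into a bound for the increments.\<close>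

lemma sum_increments_meeting_le:
  assumes C: "C \<subseteq> {c..<d}" "\<And>x. x \<in> C \<Longrightarrow> \<epsilon> \<le> a x" and "0 < \<epsilon>" and "0 < L" and n: "0 < n"
    and S: "0 \<le> S" "riesz_sum (double_phase a q) f (uniform_partition c d n) \<le> ennreal S"
  shows "(\<Sum>k\<in>cells_meeting c d n C. \<bar>f (grid c d n (Suc k)) - f (grid c d n k)\<bar>)
    \<le> L * measure lborel (\<Union>k\<in>cells_meeting c d n C. cell c d n k) + S / (\<epsilon> * L powr (q - 1))"
proof -
  let ?h = "(d - c) / real n" and ?J = "cells_meeting c d n C"
  have h: "0 < ?h" using cd n by simp
  have slope: "slope n k * ?h = \<bar>f (grid c d n (Suc k)) - f (grid c d n k)\<bar>" for k
    unfolding slope_def using h by (metis less_irrefl nonzero_eq_divide_eq)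
  have nonneg: "0 \<le> \<epsilon> * slope n k powr q * ?h" for k
    using h \<open>0 < \<epsilon>\<close> by (intro mult_nonneg_nonneg) auto
  have "(\<Sum>k\<in>?J. ennreal (\<epsilon> * slope n k powr q * ?h)) \<le>
      (\<Sum>k\<in>?J. phi_plus (double_phase a q) {grid c d n k..grid c d n (Suc k)} (slope n k) * ennreal ?h)"
  proof (rule sum_mono)
    fix k assume "k \<in> ?J"
    then obtain x where x: "x \<in> C" "x \<in> cell c d n k" by (auto simp: cells_meeting_def)
    have "\<epsilon> * slope n k powr q \<le> slope n k + a x * slope n k powr q"
      using C(2)[OF x(1)] slope_nonneg[of n k] by (simp add: add_increasing mult_right_mono)
    then have "ennreal (\<epsilon> * slope n k powr q) \<le> double_phase a q x (slope n k)"
      unfolding double_phase_def by (rule ennreal_leI)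
    also have "\<dots> \<le> phi_plus (double_phase a q) {grid c d n k..grid c d n (Suc k)} (slope n k)"
      unfolding phi_plus_def using x(2) by (intro SUP_upper) (auto simp: cell_def)
    finally have "ennreal (\<epsilon> * slope n k powr q) * ennreal ?h
        \<le> phi_plus (double_phase a q) {grid c d n k..grid c d n (Suc k)} (slope n k) * ennreal ?h"
      by (rule mult_right_mono) simp
    then show "ennreal (\<epsilon> * slope n k powr q * ?h)
        \<le> phi_plus (double_phase a q) {grid c d n k..grid c d n (Suc k)} (slope n k) * ennreal ?h"
      using h \<open>0 < \<epsilon>\<close> by (subst ennreal_mult) auto
  qed
  also have "\<dots> \<le> (\<Sum>k<n. phi_plus (double_phase a q) {grid c d n k..grid c d n (Suc k)} (slope n k) * ennreal ?h)"
    by (intro sum_mono2) (auto simp: cells_meeting_def)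
  also have "\<dots> = riesz_sum (double_phase a q) f (uniform_partition c d n)"
    unfolding riesz_sum_uniform[OF cd n] slope_def ..
  also note S(2)
  finally have "ennreal (\<Sum>k\<in>?J. \<epsilon> * slope n k powr q * ?h) \<le> ennreal S"
    unfolding sum_ennreal[OF nonneg] .
  then have "(\<Sum>k\<in>?J. \<epsilon> * slope n k powr q * ?h) \<le> S"
    using S(1) by simp
  then have sum_le: "\<epsilon> * (\<Sum>k\<in>?J. slope n k powr q * ?h) \<le> S"
    by (simp only: sum_distrib_left mult.assoc)
  have "(\<Sum>k\<in>?J. \<bar>f (grid c d n (Suc k)) - f (grid c d n k)\<bar>) = (\<Sum>k\<in>?J. slope n k * ?h)"
    unfolding slope ..
  also have "\<dots> \<le> (\<Sum>k\<in>?J. (L + slope n k powr q / L powr (q - 1)) * ?h)"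
    using le_add_powr_div[OF slope_nonneg \<open>0 < L\<close> q(1)] h by (intro sum_mono mult_right_mono) auto
  also have "\<dots> = L * (\<Sum>k\<in>?J. ?h) + (\<Sum>k\<in>?J. slope n k powr q * ?h) / L powr (q - 1)"
    unfolding distrib_right sum.distrib sum_distrib_left sum_divide_distrib times_divide_eq_left ..
  also have "(\<Sum>k\<in>?J. ?h) = measure lborel (\<Union>k\<in>?J. cell c d n k)"
  proof -
    have "measure lborel (\<Union>k\<in>?J. cell c d n k) = (\<Sum>k\<in>?J. measure lborel (cell c d n k))"
      using disjoint_family_on_mono[OF cells_meeting_subset disjoint_cells[OF cd]]
      by (intro measure_finite_Union) (auto simp: emeasure_cell)
    also have "\<dots> = (\<Sum>k\<in>?J. ?h)"
      unfolding measure_def emeasure_cell using h by (intro sum.cong refl enn2real_ennreal) simp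
    finally show ?thesis by (rule sym)
  qed
  also have "(\<Sum>k\<in>?J. slope n k powr q * ?h) / L powr (q - 1) \<le> S / (\<epsilon> * L powr (q - 1))"
    using sum_le \<open>0 < \<epsilon>\<close> \<open>0 < L\<close> by (simp add: field_simps)
  finally show ?thesis by simp
qed

text \<open>Mass on a null set requires unbounded slopes, which are too expensive where
  \<open>a\<close> is bounded away from 0. Compactness supplies that bound and makes the total
  length of the cells meeting \<open>C\<close> small.\<close>

lemma \<mu>_compact_null_eq_0:
  assumes C: "compact C" "C \<subseteq> {c..<d}" "C \<in> null_sets lborel" "\<And>x. x \<in> C \<Longrightarrow> 0 < a x"
    and fin: "upper_variation (double_phase a q) {c..d} f < \<infinity>"
  shows "\<mu> C = 0"
proof (cases "C = {}")
  case True
  then show ?thesis using signed_measure_empty[OF \<mu>] by simp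
next
  case False
  obtain z where z: "z \<in> C" "\<And>x. x \<in> C \<Longrightarrow> a z \<le> a x"
    using continuous_attains_inf[OF C(1) False, of a] continuous_on_subset[OF a_continuous] by blast
  define \<epsilon> where "\<epsilon> = a z"
  have \<epsilon>: "0 < \<epsilon>" "\<And>x. x \<in> C \<Longrightarrow> \<epsilon> \<le> a x" using C(4) z by (auto simp: \<epsilon>_def)
  obtain \<delta> where \<delta>: "0 < \<delta>" "riesz_sup (double_phase a q) {c..d} f \<delta> < \<infinity>"
    using fin unfolding upper_variation_eq_INF INF_less_iff by auto
  define S where "S = enn2real (riesz_sup (double_phase a q) {c..d} f \<delta>)"
  have S: "0 \<le> S" "riesz_sup (double_phase a q) {c..d} f \<delta> = ennreal S"
    using \<delta>(2) by (auto simp: S_def)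
  \<comment> \<open>\<open>\<Lambda>\<close> is Lebesgue measure on \<open>{c..d}\<close>; the
    cutoff makes it finite, as \<open>eventually_cells_meeting_close\<close> demands.\<close>
  define \<Lambda> where "\<Lambda> = density lborel (indicator {c..d})"
  have \<Lambda>: "emeasure \<Lambda> A = emeasure lborel (A \<inter> {c..d})" if "A \<in> sets borel" for A
    unfolding \<Lambda>_def using that by (subst emeasure_density)
      (auto simp: Int_commute indicator_inter_arith[symmetric] mult.commute)
  have \<Lambda>_finite: "finite_measure \<Lambda>"
    using \<Lambda>[of UNIV] cd by (intro finite_measureI) (auto simp: \<Lambda>_def)
  have bound: "\<bar>\<mu> C\<bar> \<le> L * e + S / (\<epsilon> * L powr (q - 1)) + e" if "0 < L" "0 < e" for L e
  proof -
    have "\<forall>\<^sub>F n in sequentially. measure \<Lambda> ((\<Union>k\<in>cells_meeting c d n C. cell c d n k) - C) < e"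
      by (rule eventually_cells_meeting_close[OF cd C(1) \<Lambda>_finite _ that(2)]) (simp add: \<Lambda>_def)
    moreover have "\<forall>\<^sub>F n in sequentially. measure \<tau> ((\<Union>k\<in>cells_meeting c d n C. cell c d n k) - C) < e"
      by (rule eventually_cells_meeting_close[OF cd C(1) \<tau>.finite_measure_axioms _ that(2)]) simp
    moreover have "\<forall>\<^sub>F n in sequentially. riesz_sum (double_phase a q) f (uniform_partition c d n) \<le> ennreal S"
      unfolding S(2)[symmetric] by (rule eventually_riesz_sum_uniform_le[OF cd \<delta>(1)])
    ultimately have "\<forall>\<^sub>F n in sequentially. \<bar>\<mu> C\<bar> \<le> L * e + S / (\<epsilon> * L powr (q - 1)) + e"
      using eventually_gt_at_top[of 0]
    proof eventually_elim
      case (elim n)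
      let ?U = "\<Union>k\<in>cells_meeting c d n C. cell c d n k"
      have U: "?U \<in> sets borel" "?U \<subseteq> {c..d}"
        using cell_subset[OF cd] by (fastforce simp: cells_meeting_def)+
      \<comment> \<open>As \<open>C\<close> is null, the total length of the cells equals that of
        their excess over \<open>C\<close>.\<close>
      have "emeasure lborel ?U = emeasure lborel (?U - C)"
        using C(3) U(1) by (intro emeasure_Diff_null_set[symmetric]) auto
      also have "\<dots> = emeasure \<Lambda> (?U - C)"
      proof -
        have "(?U - C) \<inter> {c..d} = ?U - C" using U(2) by auto
        moreover have "?U - C \<in> sets borel" using U(1) C(3) by auto
        ultimately show ?thesis by (simp add: \<Lambda>)
      qed
      finally have "measure lborel ?U < e" using elim(1) by (simp add: measure_def)
      then have "L * measure lborel ?U \<le> L * e" using that(1) by simp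
      then show ?case
        using abs_measure_compact_le[OF C(1,2) elim(4)] elim(2)
          sum_increments_meeting_le[OF C(2) \<epsilon>(2,1) that(1) elim(4) S(1) elim(3)] by linarith
    qed
    then show ?thesis by simp
  qed
  have "\<bar>\<mu> C\<bar> \<le> S / (\<epsilon> * L powr (q - 1))" if "0 < L" for L
  proof (rule field_le_epsilon)
    fix e :: real assume "0 < e"
    \<comment> \<open>With the excess bounded by \<open>e / (L + 1)\<close>, the two error terms add
      up to \<open>e\<close>.\<close>
    have "L * (e / (L + 1)) + e / (L + 1) = (L + 1) * (e / (L + 1))"
      by (simp only: distrib_right mult_1)
    also have "\<dots> = e" using that by simp
    finally show "\<bar>\<mu> C\<bar> \<le> S / (\<epsilon> * L powr (q - 1)) + e"
      using bound[OF that, of "e / (L + 1)"] that \<open>0 < e\<close> by simp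
  qed
  moreover have "((\<lambda>L. S / (\<epsilon> * L powr (q - 1))) \<longlongrightarrow> 0) at_top"
  proof -
    have "((\<lambda>L::real. L powr (1 - q)) \<longlongrightarrow> 0) at_top"
      using q(1) by (intro tendsto_neg_powr filterlim_ident) auto
    then have "((\<lambda>L::real. S / \<epsilon> * L powr (1 - q)) \<longlongrightarrow> 0) at_top"
      by (rule tendsto_mult_right_zero)
    moreover have "S / \<epsilon> * L powr (1 - q) = S / (\<epsilon> * L powr (q - 1))" for L
      using powr_minus_divide[of L "q - 1"] by simp
    ultimately show ?thesis by simp
  qed
  ultimately have "\<bar>\<mu> C\<bar> \<le> 0"
    by (intro tendsto_lowerbound[of _ 0 at_top]) (auto intro: eventually_mono[OF eventually_gt_at_top[of 0]])
  then show ?thesis by simp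
qed

text \<open>Only the part \<open>F\<close> of \<open>E\<close> on \<open>N\<close> could carry mass.
  If \<open>\<mu> F\<close> were nonzero, inner regularity with tolerance
  \<open>\<bar>\<mu> F\<bar>\<close> would give a compact null subset of nonzero value.\<close>

lemma singular_part_eq_0:
  assumes fin: "upper_variation (double_phase a q) {c..d} f < \<infinity>"
  shows "total_variation borel \<nu> {x\<in>{c..d}. 0 < a x} = 0"
proof (rule total_variation_eq_0)
  fix E assume E: "E \<in> sets borel" "E \<subseteq> {x\<in>{c..d}. 0 < a x}"
  define F where "F = (E - {d}) \<inter> N"
  have F: "F \<in> sets borel" "F \<in> null_sets lborel" "F \<subseteq> {c..<d}" "\<And>x. x \<in> F \<Longrightarrow> 0 < a x"
    using E N by (auto simp: F_def intro: null_sets_subset)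
  have "\<mu> F = 0"
  proof (rule ccontr)
    assume "\<mu> F \<noteq> 0"
    then obtain C where C: "compact C" "C \<subseteq> F" "\<bar>\<mu> F\<bar> < \<bar>\<mu> C\<bar> + \<bar>\<mu> F\<bar>"
      using inner_regular_abs[OF F(1), of "\<bar>\<mu> F\<bar>"] by auto
    have "C \<in> null_sets lborel"
      using C(1) by (intro null_sets_subset[OF F(2) _ C(2)]) (auto intro: borel_compact)
    then have "\<mu> C = 0" using C(2) F by (intro \<mu>_compact_null_eq_0 C(1) fin) auto
    with C(3) show False by simp
  qed
  moreover have "(LINT x:F|lborel. g x) = 0"
    unfolding set_lebesgue_integral_def
    by (intro integral_eq_zero_AE AE_I'[OF F(2)]) (auto simp: indicator_def)
  ultimately have "\<nu> F = 0" using decomposition[OF F(1)] by simp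
  moreover have "\<nu> ((E - {d}) - N) = 0" using E by (intro \<nu>_outside) auto
  moreover have "\<nu> (E \<inter> {d}) = 0"
    using \<nu>_d signed_measure_empty[OF \<nu>] by (cases "d \<in> E") auto
  moreover have "\<nu> (F \<union> ((E - {d}) - N)) = \<nu> F + \<nu> ((E - {d}) - N)"
    using E F(1) by (intro signed_measure_Un[OF \<nu>]) (auto simp: F_def)
  moreover have "\<nu> ((F \<union> ((E - {d}) - N)) \<union> (E \<inter> {d})) = \<nu> (F \<union> ((E - {d}) - N)) + \<nu> (E \<inter> {d})"
    using E F(1) by (intro signed_measure_Un[OF \<nu>]) (auto simp: F_def)
  moreover have "(F \<union> ((E - {d}) - N)) \<union> (E \<inter> {d}) = E" by (auto simp: F_def)
  ultimately show "\<nu> E = 0" by simp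
qed

end

subsection \<open>Upper bound\<close>

context double_phase_data
begin

lemma total_variation_le:
  assumes A: "A \<in> sets borel"
  shows "total_variation borel \<mu> A \<le> (\<integral>\<^sup>+x\<in>A. ennreal \<bar>g x\<bar> \<partial>lborel) + total_variation borel \<nu> A"
  unfolding total_variation_def[of borel \<mu>]
proof (rule SUP_least)
  fix P assume "P \<in> {P. finite P \<and> P \<subseteq> sets borel \<and> disjoint P \<and> \<Union>P = A}"
  then have P: "finite P" "P \<subseteq> sets borel" "disjoint_family_on (\<lambda>E. E) P" "\<Union>P = A"
    by (auto simp: disjoint_def disjoint_family_on_def)
  have "(\<Sum>E\<in>P. ennreal \<bar>\<mu> E\<bar>) \<le> (\<Sum>E\<in>P. (\<integral>\<^sup>+x\<in>E. ennreal \<bar>g x\<bar> \<partial>lborel) + ennreal \<bar>\<nu> E\<bar>)"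
  proof (rule sum_mono)
    fix E assume "E \<in> P"
    then have E: "E \<in> sets borel" using P by auto
    have "ennreal \<bar>\<mu> E\<bar> \<le> ennreal (\<bar>LINT x:E|lborel. g x\<bar> + \<bar>\<nu> E\<bar>)"
      using decomposition[OF E] by (intro ennreal_leI) simp
    also have "\<dots> = ennreal \<bar>LINT x:E|lborel. g x\<bar> + ennreal \<bar>\<nu> E\<bar>" by (intro ennreal_plus) auto
    also have "\<dots> \<le> (\<integral>\<^sup>+x\<in>E. ennreal \<bar>g x\<bar> \<partial>lborel) + ennreal \<bar>\<nu> E\<bar>"
      by (intro add_right_mono abs_set_integral_le_nn_integral set_integrable_g E)
    finally show "ennreal \<bar>\<mu> E\<bar> \<le> (\<integral>\<^sup>+x\<in>E. ennreal \<bar>g x\<bar> \<partial>lborel) + ennreal \<bar>\<nu> E\<bar>" .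
  qed
  also have "\<dots> \<le> (\<integral>\<^sup>+x\<in>A. ennreal \<bar>g x\<bar> \<partial>lborel) + total_variation borel \<nu> A"
    unfolding sum.distrib
  proof (rule add_mono)
    show "(\<Sum>E\<in>P. \<integral>\<^sup>+x\<in>E. ennreal \<bar>g x\<bar> \<partial>lborel) \<le> (\<integral>\<^sup>+x\<in>A. ennreal \<bar>g x\<bar> \<partial>lborel)"
      using P A by (intro sum_set_nn_integral_le) auto
    show "(\<Sum>E\<in>P. ennreal \<bar>\<nu> E\<bar>) \<le> total_variation borel \<nu> A"
      using sum_le_total_variation[OF \<nu> P(1) _ P(3)] P(2,4) by auto
  qed
  finally show "(\<Sum>E\<in>P. ennreal \<bar>\<mu> E\<bar>) \<le> (\<integral>\<^sup>+x\<in>A. ennreal \<bar>g x\<bar> \<partial>lborel) + total_variation borel \<nu> A" .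
qed

context
  assumes sing: "total_variation borel \<nu> {x\<in>{c..d}. 0 < a x} = 0"
begin

text \<open>If \<open>m\<close> is positive, so is \<open>a\<close> on the interval; then
  \<open>\<mu>\<close> has density \<open>g\<close> there and Jensen's inequality applies. If
  \<open>m = 0\<close> the left side vanishes, whatever singular mass the interval carries.\<close>

lemma jensen_on_interval:
  assumes uv: "c \<le> u" "u < v" "v \<le> d" and m: "0 \<le> m" "\<And>x. x \<in> {u..v} \<Longrightarrow> m \<le> a x"
  shows "ennreal (m * (\<bar>\<mu> {u..<v}\<bar> / (v - u)) powr q * (v - u))
    \<le> (\<integral>\<^sup>+x\<in>{u..<v}. ennreal (a x * \<bar>g x\<bar> powr q) \<partial>lborel)"
proof (cases "m = 0")
  case True
  then show ?thesis by simp
next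
  case False
  define t where "t = \<bar>\<mu> {u..<v}\<bar> / (v - u)"
  have t: "0 \<le> t" "t * (v - u) = \<bar>\<mu> {u..<v}\<bar>" using uv by (auto simp: t_def)
  have "0 < a x" if "x \<in> {u..v}" for x using m(2)[OF that] m(1) False by linarith
  then have "\<mu> {u..<v} = (LINT x:{u..<v}|lborel. g x)"
    using uv by (intro \<mu>_eq_integral[OF sing]) auto
  then have "ennreal (t * (v - u)) \<le> (\<integral>\<^sup>+x\<in>{u..<v}. ennreal \<bar>g x\<bar> \<partial>lborel)"
    unfolding t(2) using abs_set_integral_le_nn_integral[OF set_integrable_g, of "{u..<v}"] by simp
  then have "ennreal (t powr q * (v - u)) \<le> (\<integral>\<^sup>+x\<in>{u..<v}. ennreal (\<bar>g x\<bar> powr q) \<partial>lborel)"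
    using jensen_powr_nn_integral[of "\<lambda>x. \<bar>g x\<bar>" "{u..<v}" q t] uv q(1) t(1) by simp
  then have "ennreal m * ennreal (t powr q * (v - u))
      \<le> ennreal m * (\<integral>\<^sup>+x\<in>{u..<v}. ennreal (\<bar>g x\<bar> powr q) \<partial>lborel)"
    by (rule mult_left_mono) simp
  also have "\<dots> = (\<integral>\<^sup>+x. ennreal m * (ennreal (\<bar>g x\<bar> powr q) * indicator {u..<v} x) \<partial>lborel)"
    by (rule nn_integral_cmult[symmetric]) measurable
  also have "\<dots> \<le> (\<integral>\<^sup>+x\<in>{u..<v}. ennreal (a x * \<bar>g x\<bar> powr q) \<partial>lborel)"
    using m by (intro nn_integral_mono)
      (auto simp: indicator_def mult_right_mono simp flip: ennreal_mult intro!: ennreal_leI)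
  finally show ?thesis
    using m(1) uv by (simp add: t_def[symmetric] mult.assoc flip: ennreal_mult)
qed

text \<open>The Hoelder condition compares the supremum of \<open>a\<close> on the interval with its
  minimum \<open>m\<close>. The error is written as a multiple of
  \<open>\<bar>\<mu> {u..<v}\<bar>\<close>, so that summation over a partition yields the total
  variation.\<close>

lemma riesz_term_le:
  assumes uv: "c \<le> u" "u < v" "v \<le> d" "v - u \<le> \<delta>" and M: "\<bar>\<mu> {u..<v}\<bar> \<le> M"
  shows "phi_plus (double_phase a q) {u..v} (\<bar>\<mu> {u..<v}\<bar> / (v - u)) * ennreal (v - u)
    \<le> ennreal \<bar>\<mu> {u..<v}\<bar> + (\<integral>\<^sup>+x\<in>{u..<v}. ennreal (a x * \<bar>g x\<bar> powr q) \<partial>lborel)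
      + ennreal (H * \<delta> powr (\<alpha> + 1 - q) * M powr (q - 1)) * ennreal \<bar>\<mu> {u..<v}\<bar>"
proof -
  define h t D where "h = v - u" and "t = \<bar>\<mu> {u..<v}\<bar> / (v - u)" and "D = \<bar>\<mu> {u..<v}\<bar>"
  have h: "0 < h" "h \<le> \<delta>" using uv by (auto simp: h_def)
  have t: "0 \<le> t" "t * h = D" "t = D / h" and D: "0 \<le> D" "D \<le> M"
    using h uv M by (auto simp: t_def h_def D_def)
  obtain z where z: "z \<in> {u..v}" "\<And>x. x \<in> {u..v} \<Longrightarrow> a z \<le> a x"
    using continuous_attains_inf[of "{u..v}" a] continuous_on_subset[OF a_continuous] uv by auto
  define m where "m = a z"
  have m: "0 \<le> m" "\<And>x. x \<in> {u..v} \<Longrightarrow> m \<le> a x" using z a_nonneg by (auto simp: m_def)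
  have a_le: "a x \<le> m + H * h powr \<alpha>" if "x \<in> {u..v}" for x
  proof -
    have "a x - m \<le> H * \<bar>x - z\<bar> powr \<alpha>" using holder[of x z] by (simp add: m_def)
    also have "\<dots> \<le> H * h powr \<alpha>"
      using that z(1) H \<alpha> by (intro mult_left_mono powr_mono2) (auto simp: h_def)
    finally show ?thesis by simp
  qed
  have "phi_plus (double_phase a q) {u..v} t \<le> ennreal (t + (m + H * h powr \<alpha>) * t powr q)"
    unfolding phi_plus_def double_phase_def
    by (intro SUP_least ennreal_leI add_left_mono mult_right_mono a_le) auto
  then have "phi_plus (double_phase a q) {u..v} t * ennreal h
      \<le> ennreal (t + (m + H * h powr \<alpha>) * t powr q) * ennreal h"
    by (rule mult_right_mono) simp
  also have "\<dots> = ennreal (D + m * t powr q * h + H * h powr \<alpha> * t powr q * h)"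
    using h t m H by (subst ennreal_mult[symmetric]) (auto simp: algebra_simps)
  also have "\<dots> \<le> ennreal (D + m * t powr q * h + H * \<delta> powr (\<alpha> + 1 - q) * M powr (q - 1) * D)"
  proof (intro ennreal_leI add_left_mono)
    \<comment> \<open>Since \<open>t = D / h\<close>, the exponent of \<open>h\<close> becomes
      \<open>\<alpha> + 1 - q\<close>, which is positive, so \<open>h\<close> may be replaced by
      \<open>\<delta>\<close>. All of \<open>D powr q\<close> but one factor \<open>D\<close> is
      then bounded through \<open>M\<close>.\<close>
    have "h powr \<alpha> * t powr q * h = h powr (\<alpha> + 1 - q) * D powr q"
      using h t D by (simp add: powr_divide powr_diff powr_add)
    also have "D powr q = D powr (q - 1) * D"
      using D(1) by (cases "D = 0") (simp_all add: powr_diff)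
    also have "h powr (\<alpha> + 1 - q) * (D powr (q - 1) * D)
        \<le> \<delta> powr (\<alpha> + 1 - q) * (M powr (q - 1) * D)"
      using h D q by (intro mult_mono powr_mono2) auto
    finally have "H * (h powr \<alpha> * t powr q * h) \<le> H * (\<delta> powr (\<alpha> + 1 - q) * (M powr (q - 1) * D))"
      by (rule mult_left_mono) (rule H)
    then show "H * h powr \<alpha> * t powr q * h \<le> H * \<delta> powr (\<alpha> + 1 - q) * M powr (q - 1) * D"
      by (simp only: mult.assoc)
  qed
  also have "\<dots> = ennreal D + ennreal (m * t powr q * h)
      + ennreal (H * \<delta> powr (\<alpha> + 1 - q) * M powr (q - 1)) * ennreal D"
    using D m h H by (simp add: ennreal_mult)
  also have "\<dots> \<le> ennreal D + (\<integral>\<^sup>+x\<in>{u..<v}. ennreal (a x * \<bar>g x\<bar> powr q) \<partial>lborel)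
      + ennreal (H * \<delta> powr (\<alpha> + 1 - q) * M powr (q - 1)) * ennreal D"
    using jensen_on_interval[OF uv(1-3) m]
    by (intro add_mono order_refl) (simp add: h_def t_def)
  finally show ?thesis by (simp only: h_def t_def D_def)
qed

text \<open>The half-open intervals are disjoint, so the terms of \<open>riesz_term_le\<close> sum
  to quantities on the whole interval. The total mass \<open>measure \<tau> {c..<d}\<close> serves
  as \<open>M\<close> for every interval at once.\<close>

lemma riesz_sum_le:
  assumes P: "interval_partition {c..d} P" and \<delta>: "mesh P < \<delta>"
  shows "riesz_sum (double_phase a q) f P
    \<le> total_variation borel \<mu> {c..<d} + (\<integral>\<^sup>+x\<in>{c..d}. ennreal (a x * \<bar>g x\<bar> powr q) \<partial>lborel)
      + ennreal (H * \<delta> powr (\<alpha> + 1 - q) * measure \<tau> {c..<d} powr (q - 1) * measure \<tau> {c..<d})"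
proof -
  let ?M = "measure \<tau> {c..<d}"
  let ?\<kappa> = "H * \<delta> powr (\<alpha> + 1 - q) * ?M powr (q - 1)"
  have fin: "finite P" using P by (auto simp: interval_partition_def)
  have M: "total_variation borel \<mu> {c..<d} = ennreal ?M"
    using emeasure_variation_measure[OF \<mu>, of "{c..<d}"] by (simp add: \<tau>.emeasure_eq_measure)
  have "riesz_sum (double_phase a q) f P
    \<le> (\<Sum>K\<in>P. ennreal \<bar>\<mu> (half_open K)\<bar>
        + (\<integral>\<^sup>+x\<in>half_open K. ennreal (a x * \<bar>g x\<bar> powr q) \<partial>lborel)
        + ennreal ?\<kappa> * ennreal \<bar>\<mu> (half_open K)\<bar>)"
    unfolding riesz_sum_def
  proof (rule sum_mono)
    fix K assume K: "K \<in> P"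
    obtain u v where uv: "K = {u..v}" "c \<le> u" "u < v" "v \<le> d"
      using interval_partitionE[OF P K] .
    have len: "measure lborel K = v - u" using uv by simp
    have "measure lborel K \<le> mesh P"
      unfolding mesh_def using fin K by (intro Max_ge) auto
    then have "v - u \<le> \<delta>" using \<delta> len by simp
    moreover have "\<bar>\<mu> {u..<v}\<bar> \<le> ?M"
    proof -
      have "\<bar>\<mu> {u..<v}\<bar> \<le> measure \<tau> {u..<v}" by (intro abs_le_variation_measure[OF \<mu>]) simp
      also have "\<dots> \<le> ?M" using uv by (intro \<tau>.finite_measure_mono) auto
      finally show ?thesis .
    qed
    moreover have "\<bar>increment f K\<bar> = \<bar>\<mu> {u..<v}\<bar>"
      using f_diff[of u v] uv by (simp add: increment_def abs_minus_commute)
    ultimately show "phi_plus (double_phase a q) K (\<bar>increment f K\<bar> / measure lborel K) * ennreal (measure lborel K)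
      \<le> ennreal \<bar>\<mu> (half_open K)\<bar> + (\<integral>\<^sup>+x\<in>half_open K. ennreal (a x * \<bar>g x\<bar> powr q) \<partial>lborel)
        + ennreal ?\<kappa> * ennreal \<bar>\<mu> (half_open K)\<bar>"
      using riesz_term_le[OF uv(2-4)] uv(3) unfolding len by (simp add: uv(1) half_open_Icc)
  qed
  also have "\<dots> = (\<Sum>K\<in>P. ennreal \<bar>\<mu> (half_open K)\<bar>)
      + (\<Sum>K\<in>P. \<integral>\<^sup>+x\<in>half_open K. ennreal (a x * \<bar>g x\<bar> powr q) \<partial>lborel)
      + ennreal ?\<kappa> * (\<Sum>K\<in>P. ennreal \<bar>\<mu> (half_open K)\<bar>)"
    by (simp only: sum.distrib sum_distrib_left)
  also have "\<dots> \<le> ennreal ?M + (\<integral>\<^sup>+x\<in>{c..d}. ennreal (a x * \<bar>g x\<bar> powr q) \<partial>lborel)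
      + ennreal ?\<kappa> * ennreal ?M"
  proof -
    have "(\<Sum>K\<in>P. ennreal \<bar>\<mu> (half_open K)\<bar>) \<le> total_variation borel \<mu> (\<Union>K\<in>P. half_open K)"
      using disjoint_half_open[OF P] fin by (intro sum_le_total_variation[OF \<mu>]) auto
    also have "\<dots> \<le> ennreal ?M"
      unfolding M[symmetric] using UN_half_open_subset[OF P] fin
      by (intro total_variation_mono[OF \<mu>]) auto
    finally have *: "(\<Sum>K\<in>P. ennreal \<bar>\<mu> (half_open K)\<bar>) \<le> ennreal ?M" .
    have "(\<Sum>K\<in>P. \<integral>\<^sup>+x\<in>half_open K. ennreal (a x * \<bar>g x\<bar> powr q) \<partial>lborel)
        \<le> (\<integral>\<^sup>+x\<in>{c..d}. ennreal (a x * \<bar>g x\<bar> powr q) \<partial>lborel)"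
      using UN_half_open_subset[OF P] disjoint_half_open[OF P] fin
      by (intro sum_set_nn_integral_le) auto
    with * show ?thesis by (intro add_mono mult_left_mono) auto
  qed
  also have "ennreal ?\<kappa> * ennreal ?M = ennreal (?\<kappa> * ?M)"
    using H by (intro ennreal_mult[symmetric]) auto
  finally show ?thesis unfolding M .
qed

lemma upper_variation_le:
  "upper_variation (double_phase a q) {c..d} f
    \<le> (\<integral>\<^sup>+x\<in>{c..d}. ennreal (\<bar>g x\<bar> + a x * \<bar>g x\<bar> powr q) \<partial>lborel) + total_variation borel \<nu> {c..d}"
proof (rule ennreal_le_epsilon)
  fix e :: real assume e: "0 < e"
  let ?M = "measure \<tau> {c..<d}"
  let ?R = "\<lambda>\<delta>. H * \<delta> powr (\<alpha> + 1 - q) * ?M powr (q - 1) * ?M"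
  \<comment> \<open>The exponent is positive, so the limit is
    \<open>0 powr (\<alpha> + 1 - q)\<close>, which is 0. One small \<open>\<delta>\<close> then
    suffices, because the upper variation is an infimum over \<open>\<delta>\<close>.\<close>
  have "((\<lambda>\<delta>::real. \<delta> powr (\<alpha> + 1 - q)) \<longlongrightarrow> 0 powr (\<alpha> + 1 - q)) (at_right 0)"
    using q by (intro tendsto_powr' tendsto_const tendsto_ident_at)
      (auto simp: eventually_at_filter)
  then have "(?R \<longlongrightarrow> H * 0 powr (\<alpha> + 1 - q) * ?M powr (q - 1) * ?M) (at_right 0)"
    by (intro tendsto_mult tendsto_const)
  then have "(?R \<longlongrightarrow> 0) (at_right 0)" by simp
  then have "\<forall>\<^sub>F \<delta> in at_right 0. ?R \<delta> < e" using e by (rule order_tendstoD)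
  then have "\<forall>\<^sub>F \<delta> in at_right 0. ?R \<delta> < e \<and> 0 < \<delta>"
    by (intro eventually_conj eventually_at_right_less)
  then obtain \<delta> where \<delta>: "?R \<delta> < e" "0 < \<delta>"
    using eventually_happens' trivial_limit_at_right_real by (metis (no_types, lifting))
  let ?J = "\<integral>\<^sup>+x\<in>{c..d}. ennreal (a x * \<bar>g x\<bar> powr q) \<partial>lborel"
  have "upper_variation (double_phase a q) {c..d} f \<le> riesz_sup (double_phase a q) {c..d} f \<delta>"
    unfolding upper_variation_eq_INF using \<delta> by (intro INF_lower) auto
  also have "\<dots> \<le> total_variation borel \<mu> {c..<d} + ?J + ennreal (?R \<delta>)"
    unfolding riesz_sup_def by (intro SUP_least riesz_sum_le) auto
  also have "\<dots> \<le> ((\<integral>\<^sup>+x\<in>{c..d}. ennreal \<bar>g x\<bar> \<partial>lborel) + total_variation borel \<nu> {c..d}) + ?J + ennreal e"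
  proof (intro add_mono order_refl)
    have "total_variation borel \<mu> {c..<d} \<le> total_variation borel \<mu> {c..d}"
      by (intro total_variation_mono[OF \<mu>]) auto
    also have "\<dots> \<le> (\<integral>\<^sup>+x\<in>{c..d}. ennreal \<bar>g x\<bar> \<partial>lborel) + total_variation borel \<nu> {c..d}"
      by (rule total_variation_le) simp
    finally show "total_variation borel \<mu> {c..<d}
      \<le> (\<integral>\<^sup>+x\<in>{c..d}. ennreal \<bar>g x\<bar> \<partial>lborel) + total_variation borel \<nu> {c..d}" .
  qed (use \<delta> in \<open>auto intro: ennreal_leI\<close>)
  also have "\<dots> = (\<integral>\<^sup>+x\<in>{c..d}. (ennreal \<bar>g x\<bar> + ennreal (a x * \<bar>g x\<bar> powr q)) \<partial>lborel)
      + total_variation borel \<nu> {c..d} + ennreal e"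
    by (subst nn_set_integral_add) (auto simp: ac_simps)
  also have "(\<integral>\<^sup>+x\<in>{c..d}. (ennreal \<bar>g x\<bar> + ennreal (a x * \<bar>g x\<bar> powr q)) \<partial>lborel)
      = (\<integral>\<^sup>+x\<in>{c..d}. ennreal (\<bar>g x\<bar> + a x * \<bar>g x\<bar> powr q) \<partial>lborel)"
    using a_nonneg by (intro nn_integral_cong) (simp add: ennreal_plus)
  finally show "upper_variation (double_phase a q) {c..d} f
    \<le> (\<integral>\<^sup>+x\<in>{c..d}. ennreal (\<bar>g x\<bar> + a x * \<bar>g x\<bar> powr q) \<partial>lborel)
      + total_variation borel \<nu> {c..d} + ennreal e" .
qed

end

end

text \<open>A jump of \<open>f\<close> where \<open>a\<close> is positive makes the upper variation
  infinite, so the singular part vanishes on \<open>{a > 0}\<close> under a finite upper variation.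
  Given this vanishing, the formula is an equality in [0, \<infinity>], in which both sides may be
  infinite.\<close>

theorem corollary1p3:
  fixes \<Omega> :: "real set" and c d \<alpha> q :: real
    and f a f' :: "real \<Rightarrow> real" and Df Dsf :: "real set \<Rightarrow> real"
  assumes "c < d" and "{c..d} \<subseteq> \<Omega>"
    and "bounded_variation_on {c..d} f"
    and "\<forall>x\<in>{c<..d}. continuous (at_left x) f"
    and "is_derivative_measure c d f Df"
    and "is_lebesgue_decomposition {c..d} Df f' Dsf"
    and "\<forall>x\<in>\<Omega>. 0 \<le> a x" and "bounded (a ` \<Omega>)"
    and "0 < \<alpha>" and "\<alpha> \<le> 1" and "holder_continuous_on \<alpha> \<Omega> a"
    and "1 < q" and "q < 1 + \<alpha> / real DIM(real)"
  shows "(upper_variation (double_phase a q) {c..d} f < \<infinity> \<longrightarrow>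
            total_variation (restrict_space borel {c..d}) Dsf {x\<in>{c..d}. 0 < a x} = 0)
       \<and> (total_variation (restrict_space borel {c..d}) Dsf {x\<in>{c..d}. 0 < a x} = 0 \<longrightarrow>
            upper_variation (double_phase a q) {c..d} f
              = (\<integral>\<^sup>+x\<in>{c..d}. ennreal (\<bar>f' x\<bar> + a x * \<bar>f' x\<bar> powr q) \<partial>lborel)
                + total_variation (restrict_space borel {c..d}) Dsf {x\<in>{c..d}. a x = 0})"
proof -
  let ?I = "{c..d}"
  define \<mu> \<nu> where "\<mu> A = Df (A \<inter> ?I)" and "\<nu> A = Dsf (A \<inter> ?I)" for A
  \<comment> \<open>Cutting off \<open>f'\<close> outside the interval makes it integrable on the
    whole line.\<close>
  define g where "g x = indicator ?I x * f' x" for x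
  \<comment> \<open>Clamping extends \<open>a\<close> to a function that is Hoelder continuous, hence measurable, on the whole line.\<close>
  define b where "b x = a (min d (max c x))" for x
  have b_eq: "b x = a x" if "x \<in> ?I" for x using that by (simp add: b_def)
  note derivative = assms(5)[unfolded is_derivative_measure_def]
  have Df: "signed_measure (restrict_space borel ?I) Df" using derivative by (rule conjunct1)
  have f_eq: "f x = f c + Df {c..<x}" if "x \<in> ?I" for x
    using derivative that by (elim conjE) (erule (1) bspec)
  have Df_d: "Df {d} = 0" using derivative by (elim conjE)
  note decomposition = assms(6)[unfolded is_lebesgue_decomposition_def]
  have f': "set_integrable lborel ?I f'" using decomposition by (rule conjunct1)
  have Dsf: "signed_measure (restrict_space borel ?I) Dsf" using decomposition by (elim conjE)
  have dec: "Df A = (LINT x:A|lborel. f' x) + Dsf A" if "A \<in> sets (restrict_space borel ?I)" for A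
    using decomposition that by (elim conjE) (erule (1) bspec)
  obtain N where N: "N \<in> null_sets lborel"
      "\<forall>A\<in>sets (restrict_space borel ?I). A \<inter> N = {} \<longrightarrow> Dsf A = 0"
    using decomposition by (elim conjE bexE) (rule that)
  have restrict: "A \<inter> ?I \<in> sets (restrict_space borel ?I)" if "A \<in> sets borel" for A
    using that by (auto simp: sets_restrict_space)
  obtain C where C: "\<And>x y. x \<in> \<Omega> \<Longrightarrow> y \<in> \<Omega> \<Longrightarrow> \<bar>a x - a y\<bar> \<le> C * \<bar>x - y\<bar> powr \<alpha>"
    using assms(11) by (auto simp: holder_continuous_on_def)
  \<comment> \<open>The maximum guarantees a nonnegative Hoelder constant.\<close>
  define H where "H = max C 0"
  interpret double_phase_data c d f \<mu> g \<nu> N b \<alpha> q H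
  proof
    show \<mu>: "signed_measure borel \<mu>" and "signed_measure borel \<nu>"
      unfolding \<mu>_def \<nu>_def by (intro signed_measure_restrict_space Df Dsf; simp)+
    show "f v - f u = \<mu> {u..<v}" if uv: "c \<le> u" "u \<le> v" "v \<le> d" for u v
    proof -
      have "\<mu> ({c..<v} - {c..<u}) = \<mu> {c..<v} - \<mu> {c..<u}"
        using uv by (intro signed_measure_Diff[OF \<mu>]) auto
      moreover have "{c..<v} - {c..<u} = {u..<v}" using uv by auto
      moreover have "{c..<v} \<inter> ?I = {c..<v}" "{c..<u} \<inter> ?I = {c..<u}" using uv by auto
      ultimately show ?thesis using f_eq[of u] f_eq[of v] uv by (simp add: \<mu>_def)
    qed
    show "integrable lborel g" using f' by (simp add: g_def[abs_def] set_integrable_def)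
    show "\<nu> A = 0" if "A \<in> sets borel" "A \<inter> N = {}" for A
      unfolding \<nu>_def using that by (intro N(2)[rule_format] restrict) auto
    show "\<mu> A = (LINT x:A|lborel. g x) + \<nu> A" if "A \<in> sets borel" for A
    proof -
      have "(LINT x:A|lborel. g x) = (LINT x:A \<inter> ?I|lborel. f' x)"
        unfolding set_lebesgue_integral_def g_def
        by (intro Bochner_Integration.integral_cong) (auto simp: indicator_def)
      then show ?thesis unfolding \<mu>_def \<nu>_def using dec[OF restrict[OF that]] by simp
    qed
    \<comment> \<open>A single point has no length, so the normalisation \<open>Df {d} = 0\<close>
      passes to the singular part.\<close>
    show "\<nu> {d} = 0"
    proof -
      have "{d} \<inter> ?I = {d}" using assms(1) by simp
      then have "Df {d} = (LINT x:{d}|lborel. f' x) + Dsf {d}" using dec[OF restrict[of "{d}"]] by simp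
      moreover have "(LINT x:{d}|lborel. f' x) = 0"
        unfolding set_lebesgue_integral_def
        by (intro integral_eq_zero_AE AE_I'[of "{d}"]) (auto simp: indicator_def)
      ultimately show ?thesis using Df_d \<open>{d} \<inter> ?I = {d}\<close> by (simp add: \<nu>_def)
    qed
    \<comment> \<open>Clamping maps into \<open>{c..d}\<close> and does not increase distances, so
      sign and Hoelder bound carry over to \<open>b\<close>.\<close>
    have clamp: "min d (max c x) \<in> \<Omega>" for x
      using assms(1,2) by (auto simp: subset_iff min_def max_def)
    show "0 \<le> b x" for x using assms(7) clamp by (simp add: b_def)
    show "\<bar>b x - b y\<bar> \<le> H * \<bar>x - y\<bar> powr \<alpha>" for x y
    proof -
      have "\<bar>b x - b y\<bar> \<le> C * \<bar>min d (max c x) - min d (max c y)\<bar> powr \<alpha>"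
        unfolding b_def by (intro C clamp)
      also have "\<dots> \<le> H * \<bar>min d (max c x) - min d (max c y)\<bar> powr \<alpha>"
        unfolding H_def by (intro mult_right_mono) auto
      also have "\<dots> \<le> H * \<bar>x - y\<bar> powr \<alpha>"
        using assms(9) unfolding H_def by (intro mult_left_mono powr_mono2) (auto simp: min_def max_def)
      finally show ?thesis .
    qed
  qed (use assms N H_def in auto)
  have tv: "total_variation (restrict_space borel ?I) Dsf A = total_variation borel \<nu> A" if "A \<subseteq> ?I" for A
    unfolding \<nu>_def using that by (intro total_variation_restrict_space) auto
  have pos: "total_variation (restrict_space borel ?I) Dsf {x\<in>?I. 0 < a x}
      = total_variation borel \<nu> {x\<in>?I. 0 < b x}"
    using b_eq by (subst tv) (auto intro!: arg_cong[of _ _ "total_variation borel \<nu>"])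
  have V: "upper_variation (double_phase a q) ?I f = upper_variation (double_phase b q) ?I f"
    using b_eq by (intro upper_variation_cong) (simp add: double_phase_def)
  have int: "(\<integral>\<^sup>+x\<in>?I. ennreal (\<bar>g x\<bar> + b x * \<bar>g x\<bar> powr q) \<partial>lborel)
      = (\<integral>\<^sup>+x\<in>?I. ennreal (\<bar>f' x\<bar> + a x * \<bar>f' x\<bar> powr q) \<partial>lborel)"
    using b_eq by (intro nn_integral_cong) (auto simp: indicator_def g_def)
  \<comment> \<open>Since \<open>b\<close> is nonnegative, the sets where it is positive and where
    it is 0 split the interval; if the first carries no singular mass, the second carries all of
    it.\<close>
  have zero: "total_variation (restrict_space borel ?I) Dsf {x\<in>?I. a x = 0} = total_variation borel \<nu> ?I"
    if sing: "total_variation borel \<nu> {x\<in>?I. 0 < b x} = 0"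
  proof -
    have "{x. b x = 0} \<in> sets borel" by measurable
    then have Z: "{x\<in>?I. b x = 0} \<in> sets borel" by (simp add: Collect_conj_eq)
    have "total_variation borel \<nu> ({x\<in>?I. 0 < b x} \<union> {x\<in>?I. b x = 0})
        = total_variation borel \<nu> {x\<in>?I. 0 < b x} + total_variation borel \<nu> {x\<in>?I. b x = 0}"
      using positive_set_borel[OF sing] Z by (intro total_variation_Un[OF \<nu>]) auto
    also have "{x\<in>?I. 0 < b x} \<union> {x\<in>?I. b x = 0} = ?I" using a_nonneg by (auto simp: less_le)
    also have "{x\<in>?I. b x = 0} = {x\<in>?I. a x = 0}" using b_eq by auto
    finally show ?thesis using sing by (subst tv) auto
  qed
  show ?thesis
    unfolding pos V
  proof (intro conjI impI)
    assume "upper_variation (double_phase b q) ?I f < \<infinity>"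
    then show "total_variation borel \<nu> {x\<in>?I. 0 < b x} = 0" by (rule singular_part_eq_0)
  next
    assume sing: "total_variation borel \<nu> {x\<in>?I. 0 < b x} = 0"
    show "upper_variation (double_phase b q) ?I f
        = (\<integral>\<^sup>+x\<in>?I. ennreal (\<bar>f' x\<bar> + a x * \<bar>f' x\<bar> powr q) \<partial>lborel)
          + total_variation (restrict_space borel ?I) Dsf {x\<in>?I. a x = 0}"
      unfolding zero[OF sing] int[symmetric]
      by (intro antisym upper_variation_le[OF sing] upper_variation_ge[OF sing])
  qed
qed

end
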